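(* Assume $\eta_u>0$. For a sampling density $q=q_u\,q_{-u\mid u}$ let $$\sigma^2_{\mathrm{opt},u}(q)=\mathbb{E}_p\Big[w_u(\mathbf{X}_u)\,S_{q_{-u\mid u}}(\mathbf{X}_u)\Big]-\eta_u^2,\qquad S_{q_{-u\mid u}}(\mathbf{x}_u)=4\,m^2(\mathbf{x}_u)\,\nu_q(\mathbf{x}_u)+m^4(\mathbf{x}_u),$$ $$\nu_q(\mathbf{x}_u)=\mathbb{E}_p\big[w_{-u\mid u}(\mathbf{X}_{-u}\mid\mathbf{X}_u)\,\phi^2(\mathbf{X})\mid\mathbf{X}_u=\mathbf{x}_u\big]-m^2(\mathbf{x}_u),$$ be the optimal asymptotic variance for estimating $\eta_u$ under $q$. (1) For any fixed marginal $q_u$ satisfying (b), $\sigma^2_{\mathrm{opt},u}(q_u\,q_{-u\mid u})$ is minimised, over all conditional densities $q_{-u\mid u}$ such that $q_u\,q_{-u\mid u}$ is admissible, by $$q^*_{-u\mid u}(\mathbf{x}_{-u}\mid\mathbf{x}_u)=\frac{p_{-u\mid u}(\mathbf{x}_{-u}\mid\mathbf{x}_u)\,\phi(\mathbf{x})}{\mathbb{E}_p[\phi(\mathbf{X})\mid\mathbf{X}_u=\mathbf{x}_u]},$$ and for this choice $\mathbb{E}_p[w_{-u\mid u}(\mathbf{X}_{-u}\mid\mathbf{X}_u)\phi^2(\mathbf{X})\mid\mathbf{X}_u]=\big(\mathbb{E}_p[\phi(\mathbf{X})\mid\mathbf{X}_u]\big)^2$. (2) For any fixed conditional density $q_{-u\mid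 u}$ satisfying (a) at $p_u$-almost every $\mathbf{x}_u$ and with $\mathbb{E}_p\big[\sqrt{S_{q_{-u\mid u}}(\mathbf{X}_u)}\big]<\infty$, $\sigma^2_{\mathrm{opt},u}(q_u\,q_{-u\mid u})$ is minimised, over all marginal densities $q_u$ satisfying (b), by $$q_u^*(\mathbf{x}_u)=\frac{p_u(\mathbf{x}_u)\sqrt{S_{q_{-u\mid u}}(\mathbf{x}_u)}}{\mathbb{E}_p\big[\sqrt{S_{q_{-u\mid u}}(\mathbf{X}_u)}\big]},$$ with minimal value $\big(\mathbb{E}_p\big[\sqrt{S_{q_{-u\mid u}}(\mathbf{X}_u)}\big]\big)^2-\eta_u^2$. (3) Let $S_A=S_{p_{-u\mid u}}$, that is, $S_A(\mathbf{x}_u)=4m^2(\mathbf{x}_u)\nu_p(\mathbf{x}_u)+m^4(\mathbf{x}_u)$ with $\nu_p(\mathbf{x}_u)=\mathbb{E}_p[\phi^2(\mathbf{X})\mid\mathbf{X}_u=\mathbf{x}_u]-m^2(\mathbf{x}_u)$, and let $S_B=S_{q^*_{-u\mid u}}$, that is, $$S_B(\mathbf{x}_u)=4m^2(\mathbf{x}_u)\big(\mathbb{E}_p[\phi(\mathbf{X})\mid\mathbf{X}_u=\mathbf{x}_u]\big)^2-3m^4(\mathbf{x}_u).$$ Let $q_u^{A}\propto p_u\sqrt{S_A}$ and $q_u^{B}\propto p_u\sqrt{S_B}$ be the corresponding normalised marginals from (2), and let $q^*=q_u^{B}\,q^*_{-u\mid u}$. Then $S_B\le S_A$ pointwise ($p_u$-almost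 everywhere), $q^*$ minimises $\sigma^2_{\mathrm{opt},u}$ over all admissible densities, and $$\sigma^2_{\mathrm{opt},u}(q^* )\;\le\;\sigma^2_{\mathrm{opt},u}\big(q_u^{A}\,p_{-u\mid u}\big)\;\le\;\sigma^2_{\mathrm{opt},u}(p).$$
   Context: Setting. $Y=f(\mathbf{X},\mathbf{W})$ is real-valued, where $f$ is measurable, $\mathbf{X}=(X_1,\dots,X_k)$ is a random vector in $\mathbb{R}^k$ and $\mathbf{W}$ is a random vector independent of $\mathbf{X}$ with fixed distribution. $\mathbb{E}_p$ denotes expectation when $\mathbf{X}$ has the reference Lebesgue density $p$ on $\mathbb{R}^k$ (components possibly dependent), and $\mathbb{E}_p[Y^2]<\infty$. Fix a nonempty $u\subseteq\{1,\dots,k\}$; $\mathbf{X}_u=(X_j)_{j\in u}$ and $\mathbf{X}_{-u}=(X_j)_{j\notin u}$. Densities on $\mathbb{R}^k$ are factorised as marginal times conditional, $p(\mathbf{x})=p_u(\mathbf{x}_u)\,p_{-u\mid u}(\mathbf{x}_{-u}\mid\mathbf{x}_u)$ and $q(\mathbf{x})=q_u(\mathbf{x}_u)\,q_{-u\mid u}(\mathbf{x}_{-u}\mid\mathbf{x}_u)$ (conditional factors are identically $1$ if $u=\{1,\dots,k\}$). Weights: $w_u(\mathbf{x}_u)=p_u(\mathbf{x}_u)/q_u(\mathbf{x}_u)$ and $w_{-u\mid u}(\mathbf{x}_{-u}\mid\mathbf{x}_u)=p_{-u\mid u}(\mathbf{x}_{-u}\mid\mathbf{x}_u)/q_{-u\mid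 u}(\mathbf{x}_{-u}\mid\mathbf{x}_u)$. Put $m(\mathbf{x}_u)=\mathbb{E}_p[Y\mid\mathbf{X}_u=\mathbf{x}_u]$, $\eta_u=\mathbb{E}_p[m^2(\mathbf{X}_u)]$ and $\phi(\mathbf{x})=\sqrt{\mathbb{E}[Y^2\mid\mathbf{X}=\mathbf{x}]}$ (which does not depend on the density of $\mathbf{X}$). Admissibility (support condition) of $q=q_u\,q_{-u\mid u}$: (a) for almost every $\mathbf{x}_u$ with $p_u(\mathbf{x}_u)q_u(\mathbf{x}_u)>0$, one has $q_{-u\mid u}(\mathbf{x}_{-u}\mid\mathbf{x}_u)>0$ for almost every $\mathbf{x}_{-u}$ with $p_{-u\mid u}(\mathbf{x}_{-u}\mid\mathbf{x}_u)\phi(\mathbf{x})>0$; (b) $q_u(\mathbf{x}_u)>0$ for almost every $\mathbf{x}_u$ with $p_u(\mathbf{x}_u)\,m(\mathbf{x}_u)\neq0$. A conditional density "satisfies (a) at $\mathbf{x}_u$" if the positivity requirement in (a) holds at that $\mathbf{x}_u$. Conventions: $0\cdot\infty=0$; $\sigma^2_{\mathrm{opt},u}$ takes values in $[0,\infty]$; where $\mathbb{E}_p[\phi(\mathbf{X})\mid\mathbf{X}_u=\mathbf{x}_u]=0$, set $q^*_{-u\mid u}(\cdot\mid\mathbf{x}_u)=p_{-u\mid u}(\cdot\mid\mathbf{x}_u)$. *)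

theory Defs
  imports "HOL-Probability.Probability"
begin

section \<open>Conditional expectation given the value of a random variable\<close>

text \<open>
  \<open>nn_cond_exp_at P N X Z x\<close> and \<open>real_cond_exp_at P N X Z x\<close> stand for \<open>E[Z | X = x]\<close>, for
  \<open>X : P \<rightarrow> N\<close>: some measurable function \<open>g\<close> on \<open>N\<close> such that \<open>g \<circ> X\<close> is a version of
  the library's conditional expectation of \<open>Z\<close> given the sigma-algebra generated by \<open>X\<close>. Such a
  \<open>g\<close> exists (see the two lemmas below) and is unique up to null sets of the law of \<open>X\<close>.
\<close>

definition nn_cond_exp_at ::
  "'a measure \<Rightarrow> 'b measure \<Rightarrow> ('a \<Rightarrow> 'b) \<Rightarrow> ('a \<Rightarrow> ennreal) \<Rightarrow> 'b \<Rightarrow> ennreal" where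
  "nn_cond_exp_at P N X Z =
     (SOME g. g \<in> borel_measurable N \<and>
        (AE \<omega> in P. g (X \<omega>) = nn_cond_exp P (vimage_algebra (space P) X N) Z \<omega>))"

definition real_cond_exp_at ::
  "'a measure \<Rightarrow> 'b measure \<Rightarrow> ('a \<Rightarrow> 'b) \<Rightarrow> ('a \<Rightarrow> real) \<Rightarrow> 'b \<Rightarrow> real" where
  "real_cond_exp_at P N X Z =
     (SOME g. g \<in> borel_measurable N \<and>
        (AE \<omega> in P. g (X \<omega>) = real_cond_exp P (vimage_algebra (space P) X N) Z \<omega>))"

lemma vimage_algebra_factor:
  fixes h :: "'a \<Rightarrow> ennreal"
  assumes X: "X \<in> S \<rightarrow> space N" and h: "h \<in> borel_measurable (vimage_algebra S X N)"
  shows "\<exists>g \<in> borel_measurable N. \<forall>\<omega>\<in>S. h \<omega> = g (X \<omega>)"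
  using h
proof (induction rule: borel_measurable_induct)
  case (cong f g)
  then show ?case by auto
next
  case (set A)
  then obtain B where B: "B \<in> sets N" "A = X -` B \<inter> S"
    using X by (auto simp: sets_vimage_algebra2)
  then show ?case
    by (intro bexI[of _ "indicator B"]) (auto simp: indicator_def)
next
  case (mult u c)
  from mult.IH obtain g where g: "g \<in> borel_measurable N" "\<forall>\<omega>\<in>S. u \<omega> = g (X \<omega>)" by blast
  have "(\<lambda>x. c * g x) \<in> borel_measurable N" using g(1) by measurable
  then show ?case using g(2) by (intro bexI[of _ "\<lambda>x. c * g x"]) simp_all
next
  case (add u v)
  from add.IH obtain g g' where g: "g \<in> borel_measurable N" "\<forall>\<omega>\<in>S. u \<omega> = g (X \<omega>)"
    "g' \<in> borel_measurable N" "\<forall>\<omega>\<in>S. v \<omega> = g' (X \<omega>)" by blast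
  have "(\<lambda>x. g' x + g x) \<in> borel_measurable N" using g(1,3) by measurable
  then show ?case using g(2,4) by (intro bexI[of _ "\<lambda>x. g' x + g x"]) simp_all
next
  case (seq U)
  have "\<forall>i. \<exists>g. g \<in> borel_measurable N \<and> (\<forall>\<omega>\<in>S. U i \<omega> = g (X \<omega>))"
    using seq.IH by blast
  from choice[OF this] obtain G
    where G: "\<And>i. G i \<in> borel_measurable N" "\<And>i. \<forall>\<omega>\<in>S. U i \<omega> = G i (X \<omega>)"
    by blast
  have "(\<lambda>x. SUP i. G i x) \<in> borel_measurable N" using G(1) by measurable
  moreover have "\<forall>\<omega>\<in>S. (SUP i. U i) \<omega> = (SUP i. G i (X \<omega>))"
  proof
    fix \<omega> assume "\<omega> \<in> S"
    then have "U i \<omega> = G i (X \<omega>)" for i using G(2) by blast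
    then show "(SUP i. U i) \<omega> = (SUP i. G i (X \<omega>))"
      unfolding SUP_apply[where f = U and A = UNIV] by (simp only:)
  qed
  ultimately show ?case by (intro bexI[of _ "\<lambda>x. SUP i. G i x"])
qed

lemma nn_cond_exp_at:
  assumes "X \<in> measurable P N"
  shows "nn_cond_exp_at P N X Z \<in> borel_measurable N"
    and "AE \<omega> in P. nn_cond_exp_at P N X Z (X \<omega>) =
           nn_cond_exp P (vimage_algebra (space P) X N) Z \<omega>"
proof -
  have "X \<in> space P \<rightarrow> space N" using assms by (auto dest: measurable_space)
  from vimage_algebra_factor[OF this borel_measurable_nn_cond_exp]
  obtain g where "g \<in> borel_measurable N"
    "\<forall>\<omega>\<in>space P. nn_cond_exp P (vimage_algebra (space P) X N) Z \<omega> = g (X \<omega>)"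
    by blast
  then have "g \<in> borel_measurable N \<and>
        (AE \<omega> in P. g (X \<omega>) = nn_cond_exp P (vimage_algebra (space P) X N) Z \<omega>)"
    by simp
  then have "\<exists>g. g \<in> borel_measurable N \<and>
        (AE \<omega> in P. g (X \<omega>) = nn_cond_exp P (vimage_algebra (space P) X N) Z \<omega>)"
    by (rule exI[of _ g])
  from someI_ex[OF this]
  show "nn_cond_exp_at P N X Z \<in> borel_measurable N"
    and "AE \<omega> in P. nn_cond_exp_at P N X Z (X \<omega>) =
           nn_cond_exp P (vimage_algebra (space P) X N) Z \<omega>"
    unfolding nn_cond_exp_at_def by auto
qed

lemma real_cond_exp_at:
  assumes X: "X \<in> measurable P N"
  shows "real_cond_exp_at P N X Z \<in> borel_measurable N"
    and "AE \<omega> in P. real_cond_exp_at P N X Z (X \<omega>) =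
           real_cond_exp P (vimage_algebra (space P) X N) Z \<omega>"
proof -
  define g where "g = (\<lambda>x. enn2real (nn_cond_exp_at P N X (\<lambda>\<omega>. ennreal (Z \<omega>)) x)
    - enn2real (nn_cond_exp_at P N X (\<lambda>\<omega>. ennreal (- Z \<omega>)) x))"
  have "g \<in> borel_measurable N"
    unfolding g_def using nn_cond_exp_at(1)[OF X] by measurable
  moreover have "AE \<omega> in P. g (X \<omega>) = real_cond_exp P (vimage_algebra (space P) X N) Z \<omega>"
    using nn_cond_exp_at(2)[OF X, of "\<lambda>\<omega>. ennreal (Z \<omega>)"]
      nn_cond_exp_at(2)[OF X, of "\<lambda>\<omega>. ennreal (- Z \<omega>)"]
    unfolding g_def real_cond_exp_def by eventually_elim simp
  ultimately have "\<exists>g. g \<in> borel_measurable N \<and>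
        (AE \<omega> in P. g (X \<omega>) = real_cond_exp P (vimage_algebra (space P) X N) Z \<omega>)"
    by blast
  from someI_ex[OF this]
  show "real_cond_exp_at P N X Z \<in> borel_measurable N"
    and "AE \<omega> in P. real_cond_exp_at P N X Z (X \<omega>) =
           real_cond_exp P (vimage_algebra (space P) X N) Z \<omega>"
    unfolding real_cond_exp_at_def by auto
qed


section \<open>Densities\<close>

text \<open>
  Vectors indexed by a set \<open>J\<close> of coordinates are extensional functions on \<open>J\<close>; for \<open>J = {}\<close> the
  measure below is a point mass. Densities are \<open>ennreal\<close>-valued, as for the library's \<open>density\<close>.
\<close>

definition lborel_on :: "nat set \<Rightarrow> (nat \<Rightarrow> real) measure" where
  "lborel_on J = (\<Pi>\<^sub>M j\<in>J. lborel)"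

definition is_density :: "nat set \<Rightarrow> ((nat \<Rightarrow> real) \<Rightarrow> ennreal) \<Rightarrow> bool" where
  "is_density J q \<longleftrightarrow> q \<in> borel_measurable (lborel_on J) \<and> (\<integral>\<^sup>+ x. q x \<partial>lborel_on J) = 1"

text \<open>
  \<open>qc xu y\<close> is the conditional density at \<open>y\<close> of the coordinates outside \<open>u\<close>, given that those in
  \<open>u\<close> equal \<open>xu\<close>. If \<open>u = {1..k}\<close>, being a conditional density means \<open>qc = 1\<close> almost everywhere.
\<close>

definition is_cond_density ::
  "nat \<Rightarrow> nat set \<Rightarrow> ((nat \<Rightarrow> real) \<Rightarrow> (nat \<Rightarrow> real) \<Rightarrow> ennreal) \<Rightarrow> bool" where
  "is_cond_density k u qc \<longleftrightarrow>
     (\<lambda>(xu, y). qc xu y) \<in> borel_measurable (lborel_on u \<Otimes>\<^sub>M lborel_on ({1..k} - u)) \<and>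
     (AE xu in lborel_on u. (\<integral>\<^sup>+ y. qc xu y \<partial>lborel_on ({1..k} - u)) = 1)"

definition joint_density ::
  "nat \<Rightarrow> nat set \<Rightarrow> ((nat \<Rightarrow> real) \<Rightarrow> ennreal) \<Rightarrow> ((nat \<Rightarrow> real) \<Rightarrow> (nat \<Rightarrow> real) \<Rightarrow> ennreal)
    \<Rightarrow> (nat \<Rightarrow> real) \<Rightarrow> ennreal" where
  "joint_density k u qu qc x = qu (restrict x u) * qc (restrict x u) (restrict x ({1..k} - u))"

text \<open>The law of \<open>(X, W)\<close> when \<open>X\<close> has density \<open>p\<close> and \<open>W\<close> is independent of \<open>X\<close> with law \<open>L\<close>.\<close>

definition law ::
  "nat \<Rightarrow> ((nat \<Rightarrow> real) \<Rightarrow> ennreal) \<Rightarrow> 'w measure \<Rightarrow> ((nat \<Rightarrow> real) \<times> 'w) measure" where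
  "law k p L = density (lborel_on {1..k}) p \<Otimes>\<^sub>M L"


section \<open>Conditional moments of the output\<close>

text \<open>
  Throughout, \<open>P\<close> is the law of \<open>(X, W)\<close> under the reference density \<open>p\<close> with factors \<open>pu\<close> and
  \<open>pc\<close>. On this sample space \<open>X\<close> is \<open>fst\<close> and \<open>Y = f(X, W)\<close> is \<open>f\<close> itself.
\<close>

definition X_part :: "nat set \<Rightarrow> (nat \<Rightarrow> real) \<times> 'w \<Rightarrow> nat \<Rightarrow> real" where
  "X_part u \<omega> = restrict (fst \<omega>) u"

definition m_fun ::
  "nat set \<Rightarrow> ((nat \<Rightarrow> real) \<times> 'w) measure \<Rightarrow> ((nat \<Rightarrow> real) \<times> 'w \<Rightarrow> real) \<Rightarrow> (nat \<Rightarrow> real) \<Rightarrow> real"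
  where "m_fun u P f = real_cond_exp_at P (lborel_on u) (X_part u) f"

definition eta ::
  "nat set \<Rightarrow> ((nat \<Rightarrow> real) \<times> 'w) measure \<Rightarrow> ((nat \<Rightarrow> real) \<times> 'w \<Rightarrow> real) \<Rightarrow> real"
  where "eta u P f = (\<integral>\<omega>. (m_fun u P f (X_part u \<omega>))\<^sup>2 \<partial>P)"

definition ennsqrt :: "ennreal \<Rightarrow> ennreal" where
  "ennsqrt x = (if x = \<infinity> then \<infinity> else ennreal (sqrt (enn2real x)))"

text \<open>
  As \<open>X\<close> and \<open>W\<close> are independent, replacing the density of \<open>X\<close> does not change
  \<open>E[Y\<^sup>2 | X = x]\<close> (up to null sets); it is taken here under the reference law \<open>P\<close>.
\<close>

definition phi ::
  "nat \<Rightarrow> ((nat \<Rightarrow> real) \<times> 'w) measure \<Rightarrow> ((nat \<Rightarrow> real) \<times> 'w \<Rightarrow> real) \<Rightarrow> (nat \<Rightarrow> real) \<Rightarrow> ennreal"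
  where "phi k P f x =
    ennsqrt (nn_cond_exp_at P (lborel_on {1..k}) fst (\<lambda>\<omega>. ennreal ((f \<omega>)\<^sup>2)) x)"

definition phi_mean ::
  "nat \<Rightarrow> nat set \<Rightarrow> ((nat \<Rightarrow> real) \<times> 'w) measure \<Rightarrow> ((nat \<Rightarrow> real) \<times> 'w \<Rightarrow> real)
    \<Rightarrow> (nat \<Rightarrow> real) \<Rightarrow> ennreal" where
  "phi_mean k u P f = nn_cond_exp_at P (lborel_on u) (X_part u) (\<lambda>\<omega>. phi k P f (fst \<omega>))"

text \<open>\<open>E_p[\<phi>\<^sup>2(X) | X_u = xu]\<close>\<close>

definition phi_sq_mean ::
  "nat \<Rightarrow> nat set \<Rightarrow> ((nat \<Rightarrow> real) \<times> 'w) measure \<Rightarrow> ((nat \<Rightarrow> real) \<times> 'w \<Rightarrow> real)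
    \<Rightarrow> (nat \<Rightarrow> real) \<Rightarrow> ennreal" where
  "phi_sq_mean k u P f = nn_cond_exp_at P (lborel_on u) (X_part u) (\<lambda>\<omega>. (phi k P f (fst \<omega>))\<^sup>2)"

text \<open>
  \<open>E_p[w(X_{-u} | X_u) \<phi>\<^sup>2(X) | X_u = xu]\<close> with \<open>w = pc / qc\<close>. In \<open>ennreal\<close>, \<open>0 / 0 = 0\<close>,
  \<open>a / 0 = \<infinity>\<close> for \<open>a > 0\<close>, and \<open>0 * \<infinity> = 0\<close>.
\<close>

definition weighted_phi_sq_mean ::
  "nat \<Rightarrow> nat set \<Rightarrow> ((nat \<Rightarrow> real) \<times> 'w) measure \<Rightarrow> ((nat \<Rightarrow> real) \<times> 'w \<Rightarrow> real)
    \<Rightarrow> ((nat \<Rightarrow> real) \<Rightarrow> (nat \<Rightarrow> real) \<Rightarrow> ennreal)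
    \<Rightarrow> ((nat \<Rightarrow> real) \<Rightarrow> (nat \<Rightarrow> real) \<Rightarrow> ennreal) \<Rightarrow> (nat \<Rightarrow> real) \<Rightarrow> ennreal" where
  "weighted_phi_sq_mean k u P f pc qc = nn_cond_exp_at P (lborel_on u) (X_part u)
     (\<lambda>\<omega>. pc (X_part u \<omega>) (X_part ({1..k} - u) \<omega>) / qc (X_part u \<omega>) (X_part ({1..k} - u) \<omega>)
           * (phi k P f (fst \<omega>))\<^sup>2)"


section \<open>Asymptotic variance\<close>

text \<open>
  Differences are formed in \<open>ereal\<close>, so that none of them is truncated at \<open>0\<close>; also there
  \<open>0 * \<infinity> = 0\<close>. The function \<open>S_fun\<close> is nonnegative \<open>pu\<close>-almost everywhere, so \<open>e2ennreal\<close> below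
  is a mere change of type.
\<close>

definition nu ::
  "nat \<Rightarrow> nat set \<Rightarrow> ((nat \<Rightarrow> real) \<times> 'w) measure \<Rightarrow> ((nat \<Rightarrow> real) \<times> 'w \<Rightarrow> real)
    \<Rightarrow> ((nat \<Rightarrow> real) \<Rightarrow> (nat \<Rightarrow> real) \<Rightarrow> ennreal)
    \<Rightarrow> ((nat \<Rightarrow> real) \<Rightarrow> (nat \<Rightarrow> real) \<Rightarrow> ennreal) \<Rightarrow> (nat \<Rightarrow> real) \<Rightarrow> ereal" where
  "nu k u P f pc qc xu =
     enn2ereal (weighted_phi_sq_mean k u P f pc qc xu) - ereal ((m_fun u P f xu)\<^sup>2)"

definition S_fun ::
  "nat \<Rightarrow> nat set \<Rightarrow> ((nat \<Rightarrow> real) \<times> 'w) measure \<Rightarrow> ((nat \<Rightarrow> real) \<times> 'w \<Rightarrow> real)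
    \<Rightarrow> ((nat \<Rightarrow> real) \<Rightarrow> (nat \<Rightarrow> real) \<Rightarrow> ennreal)
    \<Rightarrow> ((nat \<Rightarrow> real) \<Rightarrow> (nat \<Rightarrow> real) \<Rightarrow> ennreal) \<Rightarrow> (nat \<Rightarrow> real) \<Rightarrow> ereal" where
  "S_fun k u P f pc qc xu =
     ereal (4 * (m_fun u P f xu)\<^sup>2) * nu k u P f pc qc xu + ereal ((m_fun u P f xu) ^ 4)"

definition sigma2_opt ::
  "nat \<Rightarrow> nat set \<Rightarrow> ((nat \<Rightarrow> real) \<times> 'w) measure \<Rightarrow> ((nat \<Rightarrow> real) \<times> 'w \<Rightarrow> real)
    \<Rightarrow> ((nat \<Rightarrow> real) \<Rightarrow> ennreal) \<Rightarrow> ((nat \<Rightarrow> real) \<Rightarrow> (nat \<Rightarrow> real) \<Rightarrow> ennreal)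
    \<Rightarrow> ((nat \<Rightarrow> real) \<Rightarrow> ennreal) \<Rightarrow> ((nat \<Rightarrow> real) \<Rightarrow> (nat \<Rightarrow> real) \<Rightarrow> ennreal) \<Rightarrow> ereal" where
  "sigma2_opt k u P f pu pc qu qc =
     enn2ereal (\<integral>\<^sup>+ \<omega>. pu (X_part u \<omega>) / qu (X_part u \<omega>)
                        * e2ennreal (S_fun k u P f pc qc (X_part u \<omega>)) \<partial>P)
     - ereal ((eta u P f)\<^sup>2)"

definition sqrt_S_mean ::
  "nat \<Rightarrow> nat set \<Rightarrow> ((nat \<Rightarrow> real) \<times> 'w) measure \<Rightarrow> ((nat \<Rightarrow> real) \<times> 'w \<Rightarrow> real)
    \<Rightarrow> ((nat \<Rightarrow> real) \<Rightarrow> (nat \<Rightarrow> real) \<Rightarrow> ennreal)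
    \<Rightarrow> ((nat \<Rightarrow> real) \<Rightarrow> (nat \<Rightarrow> real) \<Rightarrow> ennreal) \<Rightarrow> ennreal" where
  "sqrt_S_mean k u P f pc qc =
     (\<integral>\<^sup>+ \<omega>. ennsqrt (e2ennreal (S_fun k u P f pc qc (X_part u \<omega>))) \<partial>P)"


section \<open>Admissible sampling densities\<close>

definition supp_a_at ::
  "nat \<Rightarrow> nat set \<Rightarrow> ((nat \<Rightarrow> real) \<times> 'w) measure \<Rightarrow> ((nat \<Rightarrow> real) \<times> 'w \<Rightarrow> real)
    \<Rightarrow> ((nat \<Rightarrow> real) \<Rightarrow> (nat \<Rightarrow> real) \<Rightarrow> ennreal)
    \<Rightarrow> ((nat \<Rightarrow> real) \<Rightarrow> (nat \<Rightarrow> real) \<Rightarrow> ennreal) \<Rightarrow> (nat \<Rightarrow> real) \<Rightarrow> bool" where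
  "supp_a_at k u P f pc qc xu \<longleftrightarrow>
     (AE y in lborel_on ({1..k} - u).
        pc xu y * phi k P f (merge u ({1..k} - u) (xu, y)) > 0 \<longrightarrow> qc xu y > 0)"

definition supp_b ::
  "nat set \<Rightarrow> ((nat \<Rightarrow> real) \<times> 'w) measure \<Rightarrow> ((nat \<Rightarrow> real) \<times> 'w \<Rightarrow> real)
    \<Rightarrow> ((nat \<Rightarrow> real) \<Rightarrow> ennreal) \<Rightarrow> ((nat \<Rightarrow> real) \<Rightarrow> ennreal) \<Rightarrow> bool" where
  "supp_b u P f pu qu \<longleftrightarrow>
     (AE xu in lborel_on u. pu xu \<noteq> 0 \<and> m_fun u P f xu \<noteq> 0 \<longrightarrow> qu xu > 0)"

definition admissible ::
  "nat \<Rightarrow> nat set \<Rightarrow> ((nat \<Rightarrow> real) \<times> 'w) measure \<Rightarrow> ((nat \<Rightarrow> real) \<times> 'w \<Rightarrow> real)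
    \<Rightarrow> ((nat \<Rightarrow> real) \<Rightarrow> ennreal) \<Rightarrow> ((nat \<Rightarrow> real) \<Rightarrow> (nat \<Rightarrow> real) \<Rightarrow> ennreal)
    \<Rightarrow> ((nat \<Rightarrow> real) \<Rightarrow> ennreal) \<Rightarrow> ((nat \<Rightarrow> real) \<Rightarrow> (nat \<Rightarrow> real) \<Rightarrow> ennreal) \<Rightarrow> bool" where
  "admissible k u P f pu pc qu qc \<longleftrightarrow>
     (AE xu in lborel_on u. pu xu * qu xu > 0 \<longrightarrow> supp_a_at k u P f pc qc xu) \<and>
     supp_b u P f pu qu"


section \<open>The optimal factors\<close>

text \<open>
  \<open>E_p[\<phi>(X) | X_u = xu]\<close> is only determined up to \<open>pu\<close>-null sets. Where \<open>pu xu = 0\<close> its value is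
  arbitrary, and \<open>q\<^sup>*\<close> is set to \<open>pc\<close> as in the case \<open>E_p[\<phi>(X) | X_u = xu] = 0\<close>: this keeps it a
  conditional density when the given marginal \<open>qu\<close> charges \<open>{pu = 0}\<close>.
\<close>

definition opt_cond ::
  "nat \<Rightarrow> nat set \<Rightarrow> ((nat \<Rightarrow> real) \<times> 'w) measure \<Rightarrow> ((nat \<Rightarrow> real) \<times> 'w \<Rightarrow> real)
    \<Rightarrow> ((nat \<Rightarrow> real) \<Rightarrow> ennreal) \<Rightarrow> ((nat \<Rightarrow> real) \<Rightarrow> (nat \<Rightarrow> real) \<Rightarrow> ennreal)
    \<Rightarrow> (nat \<Rightarrow> real) \<Rightarrow> (nat \<Rightarrow> real) \<Rightarrow> ennreal" where
  "opt_cond k u P f pu pc xu y =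
     (if phi_mean k u P f xu = 0 \<or> pu xu = 0 then pc xu y
      else pc xu y * phi k P f (merge u ({1..k} - u) (xu, y)) / phi_mean k u P f xu)"

definition opt_marginal ::
  "nat \<Rightarrow> nat set \<Rightarrow> ((nat \<Rightarrow> real) \<times> 'w) measure \<Rightarrow> ((nat \<Rightarrow> real) \<times> 'w \<Rightarrow> real)
    \<Rightarrow> ((nat \<Rightarrow> real) \<Rightarrow> ennreal) \<Rightarrow> ((nat \<Rightarrow> real) \<Rightarrow> (nat \<Rightarrow> real) \<Rightarrow> ennreal)
    \<Rightarrow> ((nat \<Rightarrow> real) \<Rightarrow> (nat \<Rightarrow> real) \<Rightarrow> ennreal) \<Rightarrow> (nat \<Rightarrow> real) \<Rightarrow> ennreal" where
  "opt_marginal k u P f pu pc qc xu =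
     pu xu * ennsqrt (e2ennreal (S_fun k u P f pc qc xu)) / sqrt_S_mean k u P f pc qc"

end

theory Submission
  imports Defs
begin

text \<open>
  Everything rests on one inequality. Let \<open>p, q, s \<ge> 0\<close> with \<open>\<integral> q = 1\<close> and \<open>q > 0\<close>
  wherever \<open>p s > 0\<close>. Jensen's inequality for the function \<open>p s / q\<close> under the probability
  \<open>q\<close> gives \<open>(\<integral> p s)\<^sup>2 \<le> \<integral> (p\<^sup>2 / q) s\<^sup>2\<close>, with equality for \<open>q = p s / \<integral> p s\<close>
  (\<open>weighted_second_moment_ge\<close>, \<open>weighted_second_moment_eq\<close>). It is used twice.

  On the fibre over a fixed \<open>xu\<close>, with \<open>p = pc xu\<close>, \<open>q = qc xu\<close> and \<open>s = \<phi>\<close>, it says that the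
  weighted second moment of \<open>\<phi>\<close> is at least \<open>E[\<phi> | xu]\<^sup>2\<close>, with equality for \<open>opt_cond\<close>
  (\<open>weighted_ge\<close>, \<open>weighted_opt_cond\<close>). As \<open>S\<close> increases with that moment, \<open>opt_cond\<close>
  minimises \<open>S\<close> pointwise, hence the variance for every marginal
  (\<open>sigma2_opt_opt_cond_le\<close>). The support condition (a) is only available where \<open>qu > 0\<close>; where
  \<open>qu = 0 < pu\<close>, condition (b) forces \<open>m = 0\<close>, hence \<open>S = 0\<close>.

  On the space of \<open>xu\<close>, with \<open>p = pu\<close>, \<open>q = qu\<close> and \<open>s = sqrt S\<close>, it says that the variance is
  at least \<open>E[sqrt S]\<^sup>2 - \<eta>\<^sup>2\<close>, with equality for \<open>opt_marginal\<close> (\<open>sigma2_opt_ge\<close>,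
  \<open>sigma2_opt_opt_marginal\<close>). Condition (b) supplies the support hypothesis, since \<open>S\<close> vanishes
  where \<open>m\<close> does.

  For the optimal marginals to be densities, \<open>E[sqrt S]\<close> must be positive and finite. First,
  \<open>m\<^sup>2 \<le> E[\<phi> | xu]\<^sup>2\<close> (\<open>m_le_phi_mean\<close>), so \<open>S \<ge> m\<^sup>4\<close> and \<open>E[sqrt S] \<ge> \<eta> > 0\<close>. Secondly, with the reference
  conditional density, \<open>sqrt S \<le> 2 E[\<phi>\<^sup>2 | xu]\<close>, whose mean is \<open>2 E[Y\<^sup>2] < \<infinity>\<close>. Part (3) is then the
  composition of the two minimisations, and a comparison of the two values \<open>E[sqrt S]\<^sup>2 - \<eta>\<^sup>2\<close>.

  To argue on fibres, the abstract conditional expectations are first identified, up to null sets,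
  with integrals against \<open>pc\<close> and \<open>L\<close> (\<open>cond_exp_u\<close>, \<open>cond_exp_x\<close>).
\<close>

section \<open>Square roots of extended nonnegative reals\<close>

lemma ennsqrt_power2 [simp]: "(ennsqrt x)\<^sup>2 = x"
  by (cases x) (auto simp: ennsqrt_def ennreal_power)

lemma ennsqrt_of_power2 [simp]: "ennsqrt (x\<^sup>2) = x"
  by (cases x) (auto simp: ennsqrt_def ennreal_power power_eq_top_ennreal)

lemma ennreal_power2_mono_iff: "(a::ennreal)\<^sup>2 \<le> b\<^sup>2 \<longleftrightarrow> a \<le> b"
proof (cases "a = top \<or> b = top")
  case True
  then show ?thesis by (auto simp: power_eq_top_ennreal top_unique)
next
  case False
  then show ?thesis
    by (cases a; cases b) (auto simp: ennreal_power abs_le_square_iff[symmetric])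
qed

lemma ennsqrt_le_iff: "ennsqrt x \<le> y \<longleftrightarrow> x \<le> y\<^sup>2"
  using ennreal_power2_mono_iff[of "ennsqrt x" y] by simp

lemma le_ennsqrt_iff: "y \<le> ennsqrt x \<longleftrightarrow> y\<^sup>2 \<le> x"
  using ennreal_power2_mono_iff[of y "ennsqrt x"] by simp

lemma ennsqrt_mono: "x \<le> y \<Longrightarrow> ennsqrt x \<le> ennsqrt y"
  by (simp add: ennsqrt_le_iff)

lemma ennsqrt_eq_0_iff [simp]: "ennsqrt x = 0 \<longleftrightarrow> x = 0"
  by (metis ennsqrt_power2 ennsqrt_of_power2 power_zero_numeral)

lemma ennsqrt_measurable [measurable]: "ennsqrt \<in> borel_measurable borel"
proof -
  have "(\<lambda>x. if x = \<infinity> then \<infinity> else ennreal (sqrt (enn2real x))) \<in> borel_measurable borel"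
    by measurable
  then show ?thesis by (simp add: ennsqrt_def[abs_def])
qed

section \<open>Second moments under importance weights\<close>

lemma (in prob_space) nn_integral_power2_le:
  assumes "h \<in> borel_measurable M"
  shows "(\<integral>\<^sup>+ x. h x \<partial>M)\<^sup>2 \<le> (\<integral>\<^sup>+ x. (h x)\<^sup>2 \<partial>M)"
  using Cauchy_Schwarz_nn_integral[OF assms, of "\<lambda>_. 1"] by (simp add: emeasure_space_1)

text \<open>
  With \<open>h = p s / q\<close>, the left side is at most \<open>(\<integral> h q)\<^sup>2\<close>, because \<open>p s = 0\<close> wherever \<open>q = 0\<close>;
  the right side is at least \<open>\<integral> h\<^sup>2 q\<close>. Cancelling \<open>q\<close> uses \<open>q < \<infinity>\<close>, which \<open>\<integral> q = 1\<close> ensures almost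
  everywhere.
\<close>

lemma weighted_second_moment_ge:
  fixes p q s :: "'a \<Rightarrow> ennreal"
  assumes [measurable]: "p \<in> borel_measurable M" "q \<in> borel_measurable M" "s \<in> borel_measurable M"
    and q: "(\<integral>\<^sup>+ x. q x \<partial>M) = 1"
    and supp: "AE x in M. p x * s x > 0 \<longrightarrow> q x > 0"
  shows "(\<integral>\<^sup>+ x. p x * s x \<partial>M)\<^sup>2 \<le> (\<integral>\<^sup>+ x. p x * (p x / q x * (s x)\<^sup>2) \<partial>M)"
proof -
  interpret Q: prob_space "density M q"
    by (rule prob_spaceI) (simp add: emeasure_density q cong: nn_integral_cong)
  have fin: "AE x in M. q x \<noteq> \<infinity>"
    using q by (intro nn_integral_PInf_AE) auto
  let ?h = "\<lambda>x. p x * s x / q x"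
  have "(\<integral>\<^sup>+ x. p x * s x \<partial>M) \<le> (\<integral>\<^sup>+ x. q x * ?h x \<partial>M)"
  proof (rule nn_integral_mono_AE)
    show "AE x in M. p x * s x \<le> q x * ?h x"
      using fin supp
    proof eventually_elim
      case (elim x)
      show ?case
      proof (cases "q x = 0")
        case False
        then have "q x * ?h x = p x * s x"
          using elim by (metis ennreal_times_divide infinity_ennreal_def mult.commute mult_divide_eq_ennreal)
        then show ?thesis by simp
      qed (use elim in auto)
    qed
  qed
  also have "\<dots> = (\<integral>\<^sup>+ x. ?h x \<partial>density M q)"
    by (simp add: nn_integral_density)
  finally have "(\<integral>\<^sup>+ x. p x * s x \<partial>M)\<^sup>2 \<le> (\<integral>\<^sup>+ x. ?h x \<partial>density M q)\<^sup>2"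
    by (simp add: power_mono)
  also have "\<dots> \<le> (\<integral>\<^sup>+ x. (?h x)\<^sup>2 \<partial>density M q)"
    by (rule Q.nn_integral_power2_le) simp
  also have "\<dots> = (\<integral>\<^sup>+ x. q x * (?h x)\<^sup>2 \<partial>M)"
    by (simp add: nn_integral_density)
  also have "\<dots> \<le> (\<integral>\<^sup>+ x. p x * (p x / q x * (s x)\<^sup>2) \<partial>M)"
  proof (rule nn_integral_mono_AE)
    show "AE x in M. q x * (?h x)\<^sup>2 \<le> p x * (p x / q x * (s x)\<^sup>2)"
      using fin
    proof eventually_elim
      case (elim x)
      show ?case
      proof (cases "q x = 0")
        case False
        then have "inverse (q x) * q x = 1"
          using elim ennreal_divide_self[of "q x"] by (simp add: divide_ennreal_def less_top mult.commute)
        then have "q x * (?h x)\<^sup>2 = p x * (p x / q x * (s x)\<^sup>2)"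
          by (simp add: divide_ennreal_def power2_eq_square) (metis (no_types, opaque_lifting) mult.assoc mult.commute mult_1)
        then show ?thesis by simp
      qed simp
    qed
  qed
  finally show ?thesis .
qed

text \<open>
  For the density proportional to \<open>p s\<close> the integrand is the constant \<open>c\<close> times \<open>p s\<close>. Where
  \<open>s = 0 < p\<close> the quotient is infinite, but it is multiplied by \<open>0\<close>; the finiteness of \<open>c\<close>
  excludes \<open>s = \<infinity>\<close> outside \<open>{p = 0}\<close>.
\<close>

lemma weighted_second_moment_eq:
  fixes p s :: "'a \<Rightarrow> ennreal"
  assumes [measurable]: "p \<in> borel_measurable M" "s \<in> borel_measurable M"
    and fin: "AE x in M. p x \<noteq> \<infinity>"
    and c: "c = (\<integral>\<^sup>+ x. p x * s x \<partial>M)" "c \<noteq> 0" "c \<noteq> \<infinity>"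
  shows "(\<integral>\<^sup>+ x. p x * (p x / (p x * s x / c) * (s x)\<^sup>2) \<partial>M) = c\<^sup>2"
proof -
  have "AE x in M. p x * s x \<noteq> \<infinity>"
    using c by (intro nn_integral_PInf_AE) auto
  with fin have "AE x in M. p x * (p x / (p x * s x / c) * (s x)\<^sup>2) = c * (p x * s x)"
  proof eventually_elim
    case (elim x)
    obtain r where r: "c = ennreal r" "r > 0"
      using c(2,3) by (cases c) (auto simp: less_le)
    obtain a where a: "p x = ennreal a" "a \<ge> 0" using elim by (cases "p x") auto
    show ?case
    proof (cases "p x = 0 \<or> s x = 0")
      case False
      then obtain b where b: "s x = ennreal b" "b > 0"
        using elim by (cases "s x") (auto simp: less_le ennreal_mult_top)
      from False a have "a > 0" by (auto simp: less_le)
      then show ?thesis using a b r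
        by (simp add: ennreal_mult[symmetric] divide_ennreal ennreal_power power2_eq_square)
    qed auto
  qed
  then have "(\<integral>\<^sup>+ x. p x * (p x / (p x * s x / c) * (s x)\<^sup>2) \<partial>M) = (\<integral>\<^sup>+ x. c * (p x * s x) \<partial>M)"
    by (rule nn_integral_cong_AE)
  also have "\<dots> = c\<^sup>2"
    by (subst nn_integral_cmult) (auto simp: c(1)[symmetric] power2_eq_square)
  finally show ?thesis .
qed

section \<open>The integrand as a function of the weighted second moment\<close>

text \<open>
  \<open>S_fun\<close> depends on the conditional density only through the number \<open>V\<close>, the weighted second moment.
\<close>

definition S_of :: "real \<Rightarrow> ennreal \<Rightarrow> ereal" where
  "S_of m V = ereal (4 * m\<^sup>2) * (enn2ereal V - ereal (m\<^sup>2)) + ereal (m ^ 4)"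

lemma S_fun_eq: "S_fun k u P f pc qc xu = S_of (m_fun u P f xu) (weighted_phi_sq_mean k u P f pc qc xu)"
  by (simp add: S_fun_def nu_def S_of_def)

lemma S_of_mono: "V \<le> V' \<Longrightarrow> S_of m V \<le> S_of m V'"
  unfolding S_of_def
  by (intro add_right_mono ereal_mult_left_mono ereal_minus_mono) (auto simp: less_eq_ennreal.rep_eq)

lemma S_of_0 [simp]: "S_of 0 V = 0"
  by (simp add: S_of_def zero_ereal_def[symmetric])

lemma S_of_ennreal: "v \<ge> 0 \<Longrightarrow> S_of m (ennreal v) = ereal (4 * m\<^sup>2 * (v - m\<^sup>2) + m ^ 4)"
  by (simp add: S_of_def)

lemma S_of_ge: assumes "ennreal (m\<^sup>2) \<le> V" shows "ereal (m ^ 4) \<le> S_of m V"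
  using S_of_mono[OF assms, of m] by (simp add: S_of_ennreal)

lemma ennsqrt_S_of_ge:
  assumes "ennreal (m\<^sup>2) \<le> V"
  shows "ennreal (m\<^sup>2) \<le> ennsqrt (e2ennreal (S_of m V))"
  using e2ennreal_mono[OF S_of_ge[OF assms]]
  by (simp add: le_ennsqrt_iff ennreal_power e2ennreal_ereal flip: power_mult)

text \<open>
  \<open>S = 4 m\<^sup>2 (V - m\<^sup>2) + m\<^sup>4 \<le> 4 m\<^sup>2 V \<le> 4 V\<^sup>2\<close>. This bound makes \<open>sqrt S\<close> integrable for the
  reference conditional density.
\<close>

lemma ennsqrt_S_of_le:
  assumes "ennreal (m\<^sup>2) \<le> V"
  shows "ennsqrt (e2ennreal (S_of m V)) \<le> 2 * V"
proof (cases V)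
  case (real v)
  then have v: "m\<^sup>2 \<le> v" using assms by simp
  have "4 * m\<^sup>2 * (v - m\<^sup>2) + m ^ 4 \<le> (2 * v)\<^sup>2"
  proof -
    have "4 * m\<^sup>2 * (v - m\<^sup>2) \<le> 4 * v * (v - m\<^sup>2)" using v by (intro mult_right_mono mult_left_mono) auto
    moreover have "m ^ 4 \<le> v * m\<^sup>2" using mult_right_mono[OF v, of "m\<^sup>2"] by (simp add: power4_eq_xxxx power2_eq_square mult.assoc)
    moreover have "0 \<le> v * m\<^sup>2" using real by simp
    ultimately show ?thesis by (simp add: power2_eq_square algebra_simps)
  qed
  then have "e2ennreal (S_of m V) \<le> ennreal ((2 * v)\<^sup>2)"
    using real by (simp add: S_of_ennreal e2ennreal_ereal ennreal_leI)
  also have "\<dots> = (2 * V)\<^sup>2" 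
    using real by (simp add: ennreal_power[symmetric] ennreal_mult)
  finally show ?thesis by (simp add: ennsqrt_le_iff)
qed (simp add: ennreal_mult_top)

lemma S_of_measurable [measurable]:
  assumes [measurable]: "m \<in> borel_measurable N" "V \<in> borel_measurable N"
  shows "(\<lambda>x. S_of (m x) (V x)) \<in> borel_measurable N"
  unfolding S_of_def by measurable

section \<open>Identifying conditional expectations\<close>

lemma nn_cond_exp_at_unique:
  assumes P: "prob_space P"
    and [measurable]: "X \<in> measurable P N" "Z \<in> borel_measurable P" "K \<in> borel_measurable N"
    and eq: "\<And>A. A \<in> sets N \<Longrightarrow>
      (\<integral>\<^sup>+ \<omega>. Z \<omega> * indicator A (X \<omega>) \<partial>P) = (\<integral>\<^sup>+ \<omega>. K (X \<omega>) * indicator A (X \<omega>) \<partial>P)"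
  shows "AE x in distr P N X. nn_cond_exp_at P N X Z x = K x"
proof -
  let ?F = "vimage_algebra (space P) X N"
  interpret P: prob_space P by (rule P)
  have X: "X \<in> space P \<rightarrow> space N" using measurable_space[OF assms(2)] by auto
  have sub: "subalgebra P ?F"
    unfolding subalgebra_def using X assms(2)
    by (auto simp: sets_vimage_algebra2 intro: measurable_sets)
  interpret F: finite_measure_subalgebra P ?F
    by standard (rule sub)
  have "AE \<omega> in P. K (X \<omega>) = nn_cond_exp P ?F Z \<omega>"
  proof (rule F.nn_cond_exp_charact)
    fix B assume "B \<in> sets ?F"
    then obtain A where A: "A \<in> sets N" "B = X -` A \<inter> space P"
      using X by (auto simp: sets_vimage_algebra2)
    have ind: "indicator B \<omega> = (indicator A (X \<omega>) :: ennreal)" if "\<omega> \<in> space P" for \<omega>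
      using that A by (auto simp: indicator_def)
    show "(\<integral>\<^sup>+ \<omega> \<in> B. Z \<omega> \<partial>P) = (\<integral>\<^sup>+ \<omega> \<in> B. K (X \<omega>) \<partial>P)"
      using eq[OF A(1)] by (simp add: ind cong: nn_integral_cong)
  next
    have "X \<in> measurable ?F N" using X by (rule measurable_vimage_algebra1)
    then show "(\<lambda>\<omega>. K (X \<omega>)) \<in> borel_measurable ?F" by (rule measurable_compose) fact
  qed fact
  with nn_cond_exp_at(2)[OF assms(2), of Z]
  have "AE \<omega> in P. nn_cond_exp_at P N X Z (X \<omega>) = K (X \<omega>)" by eventually_elim simp
  moreover have [measurable]: "nn_cond_exp_at P N X Z \<in> borel_measurable N"
    by (rule nn_cond_exp_at(1)) fact
  ultimately show ?thesis by (subst AE_distr_iff) simp_all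
qed

section \<open>Lebesgue measure on coordinate blocks\<close>

lemma sigma_finite_lborel_on: "finite J \<Longrightarrow> sigma_finite_measure (lborel_on J)"
proof -
  interpret product_sigma_finite "\<lambda>_::nat. lborel :: real measure" by standard
  show "finite J \<Longrightarrow> ?thesis" unfolding lborel_on_def by (rule sigma_finite)
qed

lemma measurable_merge_lborel_on [measurable]:
  "merge I J \<in> measurable (lborel_on I \<Otimes>\<^sub>M lborel_on J) (lborel_on (I \<union> J))"
  unfolding lborel_on_def by (rule measurable_merge)

lemma measurable_restrict_lborel_on:
  "J \<subseteq> I \<Longrightarrow> (\<lambda>x. restrict x J) \<in> measurable (lborel_on I) (lborel_on J)"
  unfolding lborel_on_def by (rule measurable_restrict_subset)

lemma restrict_space_lborel_on [simp]: "x \<in> space (lborel_on J) \<Longrightarrow> restrict x J = x"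
  by (auto simp: lborel_on_def space_PiM PiE_restrict)

lemma distr_merge_lborel_on:
  assumes "I \<inter> J = {}" "finite I" "finite J"
  shows "distr (lborel_on I \<Otimes>\<^sub>M lborel_on J) (lborel_on (I \<union> J)) (merge I J) = lborel_on (I \<union> J)"
proof -
  interpret product_sigma_finite "\<lambda>_::nat. lborel :: real measure" by standard
  show ?thesis unfolding lborel_on_def using assms by (rule distr_merge)
qed

lemma nn_integral_lborel_on_Un:
  assumes "I \<inter> J = {}" "finite I" "finite J" "g \<in> borel_measurable (lborel_on (I \<union> J))"
  shows "(\<integral>\<^sup>+ x. g x \<partial>lborel_on (I \<union> J))
    = (\<integral>\<^sup>+ x. \<integral>\<^sup>+ y. g (merge I J (x, y)) \<partial>lborel_on J \<partial>lborel_on I)"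
proof -
  interpret product_sigma_finite "\<lambda>_::nat. lborel :: real measure" by standard
  show ?thesis using assms unfolding lborel_on_def by (rule product_nn_integral_fold)
qed

section \<open>The law of the inputs, disintegrated along the chosen coordinates\<close>

(* The interval {1..k} would otherwise be rewritten to {Suc 0..k}. *)
declare One_nat_def [simp del]

text \<open>
  The setting of the theorem, for noise \<open>W\<close> with values in an arbitrary probability space.
\<close>

locale reference_model =
  fixes k :: nat and u :: "nat set" and L :: "'w measure"
    and P :: "((nat \<Rightarrow> real) \<times> 'w) measure" and f :: "(nat \<Rightarrow> real) \<times> 'w \<Rightarrow> real"
    and pu :: "(nat \<Rightarrow> real) \<Rightarrow> ennreal" and pc :: "(nat \<Rightarrow> real) \<Rightarrow> (nat \<Rightarrow> real) \<Rightarrow> ennreal"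
  assumes u: "u \<subseteq> {1..k}"
    and prob_L: "prob_space L"
    and f: "f \<in> borel_measurable (lborel_on {1..k} \<Otimes>\<^sub>M L)"
    and pu: "is_density u pu" and pc: "is_cond_density k u pc"
    and P: "P = law k (joint_density k u pu pc) L"
    and Y2: "integrable P (\<lambda>\<omega>. (f \<omega>)\<^sup>2)"
begin

abbreviation "v \<equiv> {1..k} - u"
abbreviation "Mu \<equiv> lborel_on u"
abbreviation "Mv \<equiv> lborel_on v"
abbreviation "Mx \<equiv> lborel_on {1..k}"
abbreviation "Nu \<equiv> density Mu pu"
abbreviation "glue xu y \<equiv> merge u v (xu, y)"

sublocale L: prob_space L by (rule prob_L)
sublocale Mu: sigma_finite_measure Mu
  using u by (intro sigma_finite_lborel_on) (auto intro: finite_subset)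
sublocale Mv: sigma_finite_measure Mv
  by (intro sigma_finite_lborel_on) simp
sublocale uv: pair_sigma_finite Mu Mv ..

lemma uv: "u \<inter> v = {}" "u \<union> v = {1..k}" "finite u" "finite v"
  using u by (auto intro: finite_subset)

lemma measurable_f [measurable]: "f \<in> borel_measurable (Mx \<Otimes>\<^sub>M L)" by (rule f)

lemma measurable_pu [measurable]: "pu \<in> borel_measurable Mu"
  using pu by (simp add: is_density_def)

lemma measurable_glue [measurable]: "merge u v \<in> measurable (Mu \<Otimes>\<^sub>M Mv) Mx"
  using measurable_merge_lborel_on[of u v] by (simp only: uv)

lemma measurable_restrict_u [measurable]: "(\<lambda>x. restrict x u) \<in> measurable Mx Mu"
  by (rule measurable_restrict_lborel_on[OF u])

lemma measurable_restrict_v [measurable]: "(\<lambda>x. restrict x v) \<in> measurable Mx Mv"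
  by (rule measurable_restrict_lborel_on) simp

lemma cond_density_measurable:
  assumes "is_cond_density k u qc"
  shows "(\<lambda>z. qc (fst z) (snd z)) \<in> borel_measurable (Mu \<Otimes>\<^sub>M Mv)"
  using assms by (simp add: is_cond_density_def case_prod_beta')

lemmas measurable_pc [measurable] = cond_density_measurable[OF pc]

lemma cond_density_section:
  assumes qc: "is_cond_density k u qc" and xu: "xu \<in> space Mu"
  shows "qc xu \<in> borel_measurable Mv"
  using measurable_compose[OF measurable_Pair1'[OF xu] cond_density_measurable[OF qc]] by simp

lemma integral_pu: "(\<integral>\<^sup>+ x. pu x \<partial>Mu) = 1"
  using pu by (simp add: is_density_def)

lemma cond_density_integral:
  "is_cond_density k u qc \<Longrightarrow> AE xu in Mu. (\<integral>\<^sup>+ y. qc xu y \<partial>Mv) = 1"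
  by (simp add: is_cond_density_def)

lemma measurable_joint_density [measurable]:
  assumes qc: "is_cond_density k u qc" and [measurable]: "qu \<in> borel_measurable Mu"
  shows "joint_density k u qu qc \<in> borel_measurable Mx"
proof -
  have "(\<lambda>x. (restrict x u, restrict x v)) \<in> measurable Mx (Mu \<Otimes>\<^sub>M Mv)" by measurable
  from measurable_compose[OF this cond_density_measurable[OF qc]]
  have [measurable]: "(\<lambda>x. qc (restrict x u) (restrict x v)) \<in> borel_measurable Mx" by simp
  show ?thesis unfolding joint_density_def[abs_def] by measurable
qed

lemmas measurable_p [measurable] = measurable_joint_density[OF pc measurable_pu]

lemma joint_density_glue:
  "xu \<in> space Mu \<Longrightarrow> y \<in> space Mv \<Longrightarrow> joint_density k u qu qc (glue xu y) = qu xu * qc xu y"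
  using uv(1) by (simp add: joint_density_def Int_commute)

lemma sets_P [measurable_cong]: "sets P = sets (Mx \<Otimes>\<^sub>M L)"
  unfolding P law_def by (intro sets_pair_measure_cong) auto

lemma measurable_section:
  assumes [measurable]: "G \<in> borel_measurable (Mx \<Otimes>\<^sub>M L)"
  shows "(\<lambda>x. \<integral>\<^sup>+ w. G (x, w) \<partial>L) \<in> borel_measurable Mx"
  by measurable

lemma nn_integral_P_fst:
  assumes [measurable]: "G \<in> borel_measurable (Mx \<Otimes>\<^sub>M L)"
  shows "(\<integral>\<^sup>+ \<omega>. G \<omega> \<partial>P) = (\<integral>\<^sup>+ x. joint_density k u pu pc x * (\<integral>\<^sup>+ w. G (x, w) \<partial>L) \<partial>Mx)"
proof -
  have "(\<integral>\<^sup>+ \<omega>. G \<omega> \<partial>P) = (\<integral>\<^sup>+ x. \<integral>\<^sup>+ w. G (x, w) \<partial>L \<partial>density Mx (joint_density k u pu pc))"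
    unfolding P law_def by (rule L.nn_integral_fst[symmetric]) measurable
  also have "\<dots> = (\<integral>\<^sup>+ x. joint_density k u pu pc x * (\<integral>\<^sup>+ w. G (x, w) \<partial>L) \<partial>Mx)"
    by (subst nn_integral_density) (simp_all add: measurable_p)
  finally show ?thesis .
qed

text \<open>
  Fubini's theorem in the order \<open>xu\<close>, \<open>y\<close>, \<open>w\<close>, where \<open>x\<close> is glued from \<open>xu\<close> and \<open>y\<close>.
\<close>

lemma nn_integral_P:
  assumes [measurable]: "G \<in> borel_measurable (Mx \<Otimes>\<^sub>M L)"
  shows "(\<integral>\<^sup>+ \<omega>. G \<omega> \<partial>P) =
    (\<integral>\<^sup>+ xu. pu xu * (\<integral>\<^sup>+ y. pc xu y * (\<integral>\<^sup>+ w. G (glue xu y, w) \<partial>L) \<partial>Mv) \<partial>Mu)"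
proof -
  let ?H = "\<lambda>x. joint_density k u pu pc x * (\<integral>\<^sup>+ w. G (x, w) \<partial>L)"
  have [measurable]: "(\<lambda>x. \<integral>\<^sup>+ w. G (x, w) \<partial>L) \<in> borel_measurable Mx"
    by (rule measurable_section) fact
  have "(\<integral>\<^sup>+ \<omega>. G \<omega> \<partial>P) = (\<integral>\<^sup>+ x. ?H x \<partial>lborel_on (u \<union> v))"
    by (simp only: nn_integral_P_fst[OF assms] uv(2))
  also have "\<dots> = (\<integral>\<^sup>+ xu. \<integral>\<^sup>+ y. ?H (glue xu y) \<partial>Mv \<partial>Mu)"
    by (rule nn_integral_lborel_on_Un[OF uv(1,3,4)]) (simp only: uv(2), measurable)
  also have "\<dots> = (\<integral>\<^sup>+ xu. pu xu * (\<integral>\<^sup>+ y. pc xu y * (\<integral>\<^sup>+ w. G (glue xu y, w) \<partial>L) \<partial>Mv) \<partial>Mu)"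
  proof (rule nn_integral_cong)
    fix xu assume xu: "xu \<in> space Mu"
    note [measurable] = cond_density_section[OF pc xu]
    have [measurable]: "(\<lambda>y. glue xu y) \<in> measurable Mv Mx"
      using measurable_compose[OF measurable_Pair1'[OF xu] measurable_glue] .
    have "(\<integral>\<^sup>+ y. ?H (glue xu y) \<partial>Mv)
      = (\<integral>\<^sup>+ y. pu xu * (pc xu y * (\<integral>\<^sup>+ w. G (glue xu y, w) \<partial>L)) \<partial>Mv)"
      by (intro nn_integral_cong) (simp add: joint_density_glue xu mult.assoc)
    also have "\<dots> = pu xu * (\<integral>\<^sup>+ y. pc xu y * (\<integral>\<^sup>+ w. G (glue xu y, w) \<partial>L) \<partial>Mv)"
      by (rule nn_integral_cmult) measurable
    finally show "(\<integral>\<^sup>+ y. ?H (glue xu y) \<partial>Mv)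
      = pu xu * (\<integral>\<^sup>+ y. pc xu y * (\<integral>\<^sup>+ w. G (glue xu y, w) \<partial>L) \<partial>Mv)" .
  qed
  finally show ?thesis .
qed

lemma measurable_X_part_u [measurable]: "X_part u \<in> measurable P Mu"
  unfolding X_part_def[abs_def] by measurable

lemma X_part_glue: "xu \<in> space Mu \<Longrightarrow> X_part u (glue xu y, w) = xu"
   "y \<in> space Mv \<Longrightarrow> X_part v (glue xu y, w) = y"
  using uv(1) by (simp_all add: X_part_def Int_commute)

lemma nn_integral_P_u:
  assumes [measurable]: "h \<in> borel_measurable Mu"
  shows "(\<integral>\<^sup>+ \<omega>. h (X_part u \<omega>) \<partial>P) = (\<integral>\<^sup>+ xu. pu xu * h xu \<partial>Mu)"
proof -
  have "(\<integral>\<^sup>+ \<omega>. h (X_part u \<omega>) \<partial>P) = (\<integral>\<^sup>+ xu. pu xu *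
    (\<integral>\<^sup>+ y. pc xu y * (\<integral>\<^sup>+ w. h (X_part u (glue xu y, w)) \<partial>L) \<partial>Mv) \<partial>Mu)"
    by (rule nn_integral_P) (simp add: X_part_def)
  also have "\<dots> = (\<integral>\<^sup>+ xu. pu xu * h xu \<partial>Mu)"
  proof (rule nn_integral_cong_AE)
    show "AE xu in Mu. pu xu * (\<integral>\<^sup>+ y. pc xu y * (\<integral>\<^sup>+ w. h (X_part u (glue xu y, w)) \<partial>L) \<partial>Mv)
      = pu xu * h xu"
      using cond_density_integral[OF pc] AE_space
    proof eventually_elim
      case (elim xu)
      then show ?case
        by (simp add: X_part_glue L.emeasure_space_1 nn_integral_multc cond_density_section[OF pc])
    qed
  qed
  finally show ?thesis .
qed

lemma distr_X_u: "distr P Mu (X_part u) = Nu"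
proof (rule measure_eqI)
  fix A assume "A \<in> sets (distr P Mu (X_part u))"
  then have A[measurable]: "A \<in> sets Mu" by simp
  have "emeasure (distr P Mu (X_part u)) A = (\<integral>\<^sup>+ \<omega>. indicator A (X_part u \<omega>) \<partial>P)"
    by (subst nn_integral_distr[symmetric, of _ P Mu]) auto
  also have "\<dots> = emeasure Nu A"
    by (subst nn_integral_P_u) (simp_all add: emeasure_density)
  finally show "emeasure (distr P Mu (X_part u)) A = emeasure Nu A" .
qed simp

sublocale P: prob_space P
proof
  have "emeasure P (space P) = (\<integral>\<^sup>+ \<omega>. 1 \<partial>P)" by simp
  also have "\<dots> = 1" using nn_integral_P_u[of "\<lambda>_. 1"] by (simp add: integral_pu)
  finally show "emeasure P (space P) = 1" .
qed

lemma AE_Nu: "(AE xu in Nu. Q xu) \<longleftrightarrow> (AE xu in Mu. pu xu \<noteq> 0 \<longrightarrow> Q xu)"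
  by (subst AE_density) (simp_all add: zero_less_iff_neq_zero)

lemma AE_Nu_if_Mu: "AE xu in Mu. Q xu \<Longrightarrow> AE xu in Nu. Q xu"
  unfolding AE_Nu by (erule eventually_mono) simp

text \<open>
  Conditioning on \<open>X_u\<close> integrates out the other coordinates against \<open>pc\<close> and the noise against \<open>L\<close>:
  by \<open>nn_integral_P\<close>, this kernel has the right integral over every event determined by \<open>X_u\<close>.
\<close>

lemma cond_exp_u:
  assumes Z[measurable]: "Z \<in> borel_measurable (Mx \<Otimes>\<^sub>M L)"
  shows "AE xu in Nu. nn_cond_exp_at P Mu (X_part u) Z xu
    = (\<integral>\<^sup>+ y. pc xu y * (\<integral>\<^sup>+ w. Z (glue xu y, w) \<partial>L) \<partial>Mv)"
proof -
  let ?K = "\<lambda>xu. \<integral>\<^sup>+ y. pc xu y * (\<integral>\<^sup>+ w. Z (glue xu y, w) \<partial>L) \<partial>Mv"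
  have [measurable]: "(\<lambda>x. \<integral>\<^sup>+ w. Z (x, w) \<partial>L) \<in> borel_measurable Mx"
    by (rule measurable_section) fact
  have K: "(\<lambda>z. pc (fst z) (snd z) * (\<integral>\<^sup>+ w. Z (merge u v z, w) \<partial>L)) \<in> borel_measurable (Mu \<Otimes>\<^sub>M Mv)"
    by measurable
  have [measurable]: "?K \<in> borel_measurable Mu"
    using Mv.borel_measurable_nn_integral_fst[OF K] by simp
  have "AE xu in distr P Mu (X_part u). nn_cond_exp_at P Mu (X_part u) Z xu = ?K xu"
  proof (rule nn_cond_exp_at_unique)
    fix A assume [measurable]: "A \<in> sets Mu"
    have "(\<integral>\<^sup>+ \<omega>. Z \<omega> * indicator A (X_part u \<omega>) \<partial>P) = (\<integral>\<^sup>+ xu. pu xu *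
      (\<integral>\<^sup>+ y. pc xu y * (\<integral>\<^sup>+ w. Z (glue xu y, w) * indicator A (X_part u (glue xu y, w)) \<partial>L) \<partial>Mv) \<partial>Mu)"
      by (rule nn_integral_P) (simp add: X_part_def)
    also have "\<dots> = (\<integral>\<^sup>+ xu. pu xu * (?K xu * indicator A xu) \<partial>Mu)"
      by (intro nn_integral_cong) (simp add: X_part_glue indicator_def)
    also have "\<dots> = (\<integral>\<^sup>+ \<omega>. ?K (X_part u \<omega>) * indicator A (X_part u \<omega>) \<partial>P)"
      by (rule nn_integral_P_u[symmetric]) measurable
    finally show "(\<integral>\<^sup>+ \<omega>. Z \<omega> * indicator A (X_part u \<omega>) \<partial>P) = \<dots>" .
  qed (simp_all add: P.prob_space_axioms)
  then show ?thesis by (simp only: distr_X_u)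
qed

lemma cond_exp_x:
  assumes Z[measurable]: "Z \<in> borel_measurable (Mx \<Otimes>\<^sub>M L)"
  shows "AE x in density Mx (joint_density k u pu pc). nn_cond_exp_at P Mx fst Z x = (\<integral>\<^sup>+ w. Z (x, w) \<partial>L)"
proof -
  let ?K = "\<lambda>x. \<integral>\<^sup>+ w. Z (x, w) \<partial>L"
  let ?p = "joint_density k u pu pc"
  have [measurable]: "?K \<in> borel_measurable Mx"
    by (rule measurable_section) fact
  have fst_P: "fst \<in> measurable P Mx" by measurable
  have "distr P Mx fst = density Mx ?p"
  proof (rule measure_eqI)
    fix A assume "A \<in> sets (distr P Mx fst)"
    then have A[measurable]: "A \<in> sets Mx" by simp
    have "emeasure (distr P Mx fst) A = (\<integral>\<^sup>+ \<omega>. indicator A (fst \<omega>) \<partial>P)"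
      using fst_P by (subst nn_integral_distr[symmetric, of _ P Mx]) auto
    also have "\<dots> = emeasure (density Mx ?p) A"
      by (subst nn_integral_P_fst) (simp_all add: emeasure_density measurable_p L.emeasure_space_1)
    finally show "emeasure (distr P Mx fst) A = emeasure (density Mx ?p) A" .
  qed simp
  moreover have "AE x in distr P Mx fst. nn_cond_exp_at P Mx fst Z x = ?K x"
  proof (rule nn_cond_exp_at_unique)
    fix A assume [measurable]: "A \<in> sets Mx"
    have "(\<integral>\<^sup>+ \<omega>. Z \<omega> * indicator A (fst \<omega>) \<partial>P) = (\<integral>\<^sup>+ x. ?p x * (\<integral>\<^sup>+ w. Z (x, w) * indicator A x \<partial>L) \<partial>Mx)"
      by (subst nn_integral_P_fst) simp_all
    also have "\<dots> = (\<integral>\<^sup>+ x. ?p x * (\<integral>\<^sup>+ w. ?K x * indicator A x \<partial>L) \<partial>Mx)"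
      by (intro nn_integral_cong) (simp add: indicator_def L.emeasure_space_1)
    also have "\<dots> = (\<integral>\<^sup>+ \<omega>. ?K (fst \<omega>) * indicator A (fst \<omega>) \<partial>P)"
      by (subst nn_integral_P_fst) simp_all
    finally show "(\<integral>\<^sup>+ \<omega>. Z \<omega> * indicator A (fst \<omega>) \<partial>P) = \<dots>" .
  qed (simp_all add: P.prob_space_axioms fst_P)
  ultimately show ?thesis by (simp only:)
qed

text \<open>
  Null sets of the joint law are null on almost every fibre. The function \<open>\<phi>\<close> is characterised only up
  to null sets of the joint law, so its properties are carried to the fibres by this lemma.
\<close>

lemma AE_glue:
  assumes "AE x in density Mx (joint_density k u pu pc). Q x"
  shows "AE xu in Nu. AE y in Mv. pc xu y \<noteq> 0 \<longrightarrow> Q (glue xu y)"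
proof -
  let ?p = "joint_density k u pu pc"
  have "AE x in Mx. ?p x \<noteq> 0 \<longrightarrow> Q x"
    using assms by (subst (asm) AE_density) (simp_all add: zero_less_iff_neq_zero measurable_p)
  also have "Mx = distr (Mu \<Otimes>\<^sub>M Mv) Mx (merge u v)"
    using distr_merge_lborel_on[OF uv(1,3,4)] by (simp only: uv(2))
  finally have "AE z in Mu \<Otimes>\<^sub>M Mv. ?p (merge u v z) \<noteq> 0 \<longrightarrow> Q (merge u v z)"
    by (rule AE_distrD[rotated]) measurable
  from uv.AE_pair[OF this]
  have "AE xu in Mu. AE y in Mv. ?p (glue xu y) \<noteq> 0 \<longrightarrow> Q (glue xu y)" by simp
  then have "AE xu in Mu. pu xu \<noteq> 0 \<longrightarrow> (AE y in Mv. pc xu y \<noteq> 0 \<longrightarrow> Q (glue xu y))"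
    using AE_space
  proof eventually_elim
    case (elim xu)
    show ?case
    proof
      assume "pu xu \<noteq> 0"
      from elim(1) AE_space show "AE y in Mv. pc xu y \<noteq> 0 \<longrightarrow> Q (glue xu y)"
        by eventually_elim (use \<open>pu xu \<noteq> 0\<close> elim(2) in \<open>simp add: joint_density_glue\<close>)
    qed
  qed
  then show ?thesis by (simp only: AE_Nu)
qed

section \<open>Conditional moments as integrals over fibres\<close>

abbreviation "\<phi> \<equiv> phi k P f"
abbreviation "m \<equiv> m_fun u P f"
abbreviation "\<mu> \<equiv> phi_mean k u P f"

lemma glue_section [measurable]: "xu \<in> space Mu \<Longrightarrow> (\<lambda>y. glue xu y) \<in> measurable Mv Mx"
  using measurable_compose[OF measurable_Pair1' measurable_glue] .

lemma measurable_phi [measurable]: "\<phi> \<in> borel_measurable Mx"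
proof -
  have "fst \<in> measurable P Mx" by measurable
  from nn_cond_exp_at(1)[OF this] have [measurable]: "\<And>Z. nn_cond_exp_at P Mx fst Z \<in> borel_measurable Mx" .
  show ?thesis unfolding phi_def[abs_def] by measurable
qed

lemma measurable_m [measurable]: "m \<in> borel_measurable Mu"
  unfolding m_fun_def by (rule real_cond_exp_at(1)) measurable

lemma measurable_phi_mean [measurable]: "\<mu> \<in> borel_measurable Mu"
  unfolding phi_mean_def by (rule nn_cond_exp_at(1)) measurable

lemma measurable_phi_sq_mean [measurable]: "phi_sq_mean k u P f \<in> borel_measurable Mu"
  unfolding phi_sq_mean_def by (rule nn_cond_exp_at(1)) measurable

lemma measurable_weighted [measurable]: "weighted_phi_sq_mean k u P f pc qc \<in> borel_measurable Mu"
  unfolding weighted_phi_sq_mean_def by (rule nn_cond_exp_at(1)) measurable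

lemma phi_power2: "AE x in density Mx (joint_density k u pu pc).
    (\<phi> x)\<^sup>2 = (\<integral>\<^sup>+ w. ennreal ((f (x, w))\<^sup>2) \<partial>L)"
  unfolding phi_def ennsqrt_power2 by (rule cond_exp_x) measurable

lemma cond_exp_u_of_x:
  assumes [measurable]: "h \<in> borel_measurable Mx"
  shows "AE xu in Nu. nn_cond_exp_at P Mu (X_part u) (\<lambda>\<omega>. h (fst \<omega>)) xu
    = (\<integral>\<^sup>+ y. pc xu y * h (glue xu y) \<partial>Mv)"
  using cond_exp_u[of "\<lambda>\<omega>. h (fst \<omega>)"] by (simp add: L.emeasure_space_1)

lemma nn_integral_pu_mono:
  assumes "AE xu in Nu. a xu \<le> b xu"
  shows "(\<integral>\<^sup>+ xu. pu xu * a xu \<partial>Mu) \<le> (\<integral>\<^sup>+ xu. pu xu * b xu \<partial>Mu)"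
proof (rule nn_integral_mono_AE)
  show "AE xu in Mu. pu xu * a xu \<le> pu xu * b xu"
    using assms unfolding AE_Nu
  proof eventually_elim
    case (elim xu)
    then show ?case by (cases "pu xu = 0") (auto intro: mult_left_mono)
  qed
qed

lemma phi_mean_eq: "AE xu in Nu. \<mu> xu = (\<integral>\<^sup>+ y. pc xu y * \<phi> (glue xu y) \<partial>Mv)"
  unfolding phi_mean_def by (rule cond_exp_u_of_x) measurable

lemma phi_sq_mean_eq: "AE xu in Nu. phi_sq_mean k u P f xu = (\<integral>\<^sup>+ y. pc xu y * (\<phi> (glue xu y))\<^sup>2 \<partial>Mv)"
  unfolding phi_sq_mean_def by (rule cond_exp_u_of_x) measurable

lemma weighted_eq:
  assumes qc: "is_cond_density k u qc"
  shows "AE xu in Nu. weighted_phi_sq_mean k u P f pc qc xu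
    = (\<integral>\<^sup>+ y. pc xu y * (pc xu y / qc xu y * (\<phi> (glue xu y))\<^sup>2) \<partial>Mv)"
proof -
  have r: "(\<lambda>\<omega>. (X_part u \<omega>, X_part v \<omega>)) \<in> measurable (Mx \<Otimes>\<^sub>M L) (Mu \<Otimes>\<^sub>M Mv)"
    unfolding X_part_def by measurable
  from measurable_compose[OF r cond_density_measurable[OF qc]] measurable_compose[OF r measurable_pc]
  have [measurable]: "(\<lambda>\<omega>. qc (X_part u \<omega>) (X_part v \<omega>)) \<in> borel_measurable (Mx \<Otimes>\<^sub>M L)"
    "(\<lambda>\<omega>. pc (X_part u \<omega>) (X_part v \<omega>)) \<in> borel_measurable (Mx \<Otimes>\<^sub>M L)" by simp_all
  have "AE xu in Nu. weighted_phi_sq_mean k u P f pc qc xu = (\<integral>\<^sup>+ y. pc xu y *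
      (\<integral>\<^sup>+ w. pc (X_part u (glue xu y, w)) (X_part v (glue xu y, w))
        / qc (X_part u (glue xu y, w)) (X_part v (glue xu y, w)) * (\<phi> (fst (glue xu y, w)))\<^sup>2 \<partial>L) \<partial>Mv)"
    unfolding weighted_phi_sq_mean_def by (rule cond_exp_u) measurable
  then show ?thesis using AE_Nu_if_Mu[OF AE_space]
  proof eventually_elim
    case (elim xu)
    show ?case unfolding elim(1)
      by (intro nn_integral_cong) (simp add: X_part_glue elim(2) L.emeasure_space_1)
  qed
qed

lemma pc_finite: "AE xu in Mu. AE y in Mv. pc xu y \<noteq> \<infinity>"
  using cond_density_integral[OF pc] AE_space
proof eventually_elim
  case (elim xu)
  then show ?case by (intro nn_integral_PInf_AE cond_density_section[OF pc]) auto
qed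

text \<open>
  The basic inequality on the fibre over \<open>xu\<close>; its support hypothesis is condition (a) at \<open>xu\<close>.
\<close>

lemma weighted_ge:
  assumes qc: "is_cond_density k u qc"
  shows "AE xu in Nu. supp_a_at k u P f pc qc xu \<longrightarrow> (\<mu> xu)\<^sup>2 \<le> weighted_phi_sq_mean k u P f pc qc xu"
  using weighted_eq[OF qc] phi_mean_eq AE_Nu_if_Mu[OF cond_density_integral[OF qc]] AE_Nu_if_Mu[OF AE_space]
proof eventually_elim
  case (elim xu)
  note [measurable] = cond_density_section[OF qc elim(4)] cond_density_section[OF pc elim(4)] glue_section[OF elim(4)]
  show ?case
  proof
    assume "supp_a_at k u P f pc qc xu"
    then show "(\<mu> xu)\<^sup>2 \<le> weighted_phi_sq_mean k u P f pc qc xu"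
      unfolding elim(1,2) supp_a_at_def
      by (intro weighted_second_moment_ge elim(3)) (simp_all add: elim(4))
  qed
qed

lemma weighted_pc: "AE xu in Nu. weighted_phi_sq_mean k u P f pc pc xu = phi_sq_mean k u P f xu"
  using weighted_eq[OF pc] phi_sq_mean_eq AE_Nu_if_Mu[OF pc_finite]
proof eventually_elim
  case (elim xu)
  show ?case unfolding elim(1,2)
  proof (rule nn_integral_cong_AE)
    show "AE y in Mv. pc xu y * (pc xu y / pc xu y * (\<phi> (glue xu y))\<^sup>2) = pc xu y * (\<phi> (glue xu y))\<^sup>2"
      using elim(3)
    proof eventually_elim
      case (elim y)
      then show ?case by (cases "pc xu y = 0") (simp_all add: ennreal_divide_self less_top)
    qed
  qed
qed

lemma supp_a_pc: "supp_a_at k u P f pc pc xu"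
  unfolding supp_a_at_def by (auto intro!: AE_I2 simp: zero_less_iff_neq_zero)

text \<open>
  By the tower property the integral equals \<open>E[Y\<^sup>2]\<close>.
\<close>

lemma nn_integral_phi_sq_mean: "(\<integral>\<^sup>+ xu. pu xu * phi_sq_mean k u P f xu \<partial>Mu) < \<infinity>"
proof -
  let ?p = "joint_density k u pu pc"
  have "(\<integral>\<^sup>+ xu. pu xu * phi_sq_mean k u P f xu \<partial>Mu)
    = (\<integral>\<^sup>+ xu. pu xu * (\<integral>\<^sup>+ y. pc xu y * (\<integral>\<^sup>+ w. (\<phi> (fst (glue xu y, w)))\<^sup>2 \<partial>L) \<partial>Mv) \<partial>Mu)"
    using phi_sq_mean_eq unfolding AE_Nu
    by (intro nn_integral_cong_AE) (auto elim!: eventually_mono simp: L.emeasure_space_1)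
  also have "\<dots> = (\<integral>\<^sup>+ \<omega>. (\<phi> (fst \<omega>))\<^sup>2 \<partial>P)"
    by (rule nn_integral_P[symmetric]) measurable
  also have "\<dots> = (\<integral>\<^sup>+ x. ?p x * (\<phi> x)\<^sup>2 \<partial>Mx)"
    by (subst nn_integral_P_fst) (simp_all add: L.emeasure_space_1)
  also have "\<dots> = (\<integral>\<^sup>+ x. ?p x * (\<integral>\<^sup>+ w. ennreal ((f (x, w))\<^sup>2) \<partial>L) \<partial>Mx)"
    using phi_power2
    by (subst (asm) AE_density) (auto intro!: nn_integral_cong_AE elim!: eventually_mono
      simp: measurable_p zero_less_iff_neq_zero)
  also have "\<dots> = (\<integral>\<^sup>+ \<omega>. ennreal ((f \<omega>)\<^sup>2) \<partial>P)"
    by (rule nn_integral_P_fst[symmetric]) measurable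
  also have "\<dots> < \<infinity>"
    using Y2 by (simp add: integrable_iff_bounded)
  finally show ?thesis .
qed

lemma phi_mean_power2_le: "AE xu in Nu. (\<mu> xu)\<^sup>2 \<le> phi_sq_mean k u P f xu"
  using weighted_ge[OF pc] weighted_pc by eventually_elim (simp add: supp_a_pc)

lemma phi_sq_mean_finite: "AE xu in Nu. phi_sq_mean k u P f xu \<noteq> \<infinity>"
proof -
  have "AE xu in Mu. pu xu * phi_sq_mean k u P f xu \<noteq> \<infinity>"
    using nn_integral_phi_sq_mean by (intro nn_integral_PInf_AE) auto
  then show ?thesis unfolding AE_Nu
    by eventually_elim (auto simp: ennreal_mult_top)
qed

lemma phi_mean_finite: "AE xu in Nu. \<mu> xu \<noteq> \<infinity>"
  using phi_mean_power2_le phi_sq_mean_finite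
  by eventually_elim (auto simp: top_unique)

lemma abs_f_le_phi: "AE x in density Mx (joint_density k u pu pc). (\<integral>\<^sup>+ w. ennreal \<bar>f (x, w)\<bar> \<partial>L) \<le> \<phi> x"
  using phi_power2 AE_space
proof eventually_elim
  case (elim x)
  then have x: "x \<in> space Mx" by simp
  have [measurable]: "(\<lambda>w. f (x, w)) \<in> borel_measurable L"
    using measurable_compose[OF measurable_Pair1'[OF x] f] .
  have "(\<integral>\<^sup>+ w. ennreal \<bar>f (x, w)\<bar> \<partial>L)\<^sup>2 \<le> (\<integral>\<^sup>+ w. (ennreal \<bar>f (x, w)\<bar>)\<^sup>2 \<partial>L)"
    by (rule L.nn_integral_power2_le) measurable
  also have "\<dots> = (\<phi> x)\<^sup>2"
    unfolding elim(1) by (simp add: ennreal_power)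
  finally show ?case by (simp add: ennreal_power2_mono_iff)
qed

text \<open>
  Three steps: \<open>\<bar>m\<bar>\<close> is at most the sum of the conditional expectations of the positive and negative
  parts of \<open>Y\<close>; this sum is the integral of \<open>E[\<bar>Y\<bar> | X]\<close> over the fibre; and \<open>E[\<bar>Y\<bar> | X] \<le> \<phi>(X)\<close> by
  Jensen's inequality.
\<close>

lemma m_le_phi_mean: "AE xu in Nu. ennreal ((m xu)\<^sup>2) \<le> (\<mu> xu)\<^sup>2"
proof -
  let ?g = "\<lambda>Z. nn_cond_exp_at P Mu (X_part u) Z"
  let ?pos = "\<lambda>\<omega>. ennreal (f \<omega>)" and ?neg = "\<lambda>\<omega>. ennreal (- f \<omega>)"
  have [measurable]: "?g Z \<in> borel_measurable Mu" for Z
    by (rule nn_cond_exp_at(1)) measurable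
  have "AE \<omega> in P. ennreal \<bar>m (X_part u \<omega>)\<bar> \<le> ?g ?pos (X_part u \<omega>) + ?g ?neg (X_part u \<omega>)"
    using real_cond_exp_at(2)[OF measurable_X_part_u, of f]
      nn_cond_exp_at(2)[OF measurable_X_part_u, of ?pos]
      nn_cond_exp_at(2)[OF measurable_X_part_u, of ?neg]
  proof eventually_elim
    case (elim \<omega>)
    have le: "ennreal \<bar>enn2real a - enn2real b\<bar> \<le> a + b" for a b
      by (cases a; cases b) (auto simp: ennreal_plus[symmetric] simp del: ennreal_plus)
    show ?case
      unfolding m_fun_def elim real_cond_exp_def by (rule le)
  qed
  then have "AE xu in distr P Mu (X_part u). ennreal \<bar>m xu\<bar> \<le> ?g ?pos xu + ?g ?neg xu"
    by (subst AE_distr_iff) simp_all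
  then have "AE xu in Nu. ennreal \<bar>m xu\<bar> \<le> ?g ?pos xu + ?g ?neg xu"
    by (simp only: distr_X_u)
  moreover have "AE xu in Nu. ?g ?pos xu = (\<integral>\<^sup>+ y. pc xu y * (\<integral>\<^sup>+ w. ?pos (glue xu y, w) \<partial>L) \<partial>Mv)"
    by (rule cond_exp_u) measurable
  moreover have "AE xu in Nu. ?g ?neg xu = (\<integral>\<^sup>+ y. pc xu y * (\<integral>\<^sup>+ w. ?neg (glue xu y, w) \<partial>L) \<partial>Mv)"
    by (rule cond_exp_u) measurable
  ultimately show ?thesis
    using phi_mean_eq AE_glue[OF abs_f_le_phi] AE_Nu_if_Mu[OF AE_space]
  proof eventually_elim
    case (elim xu)
    have xu: "xu \<in> space Mu" using elim by simp
    note [measurable] = cond_density_section[OF pc xu] glue_section[OF xu]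
    have [measurable]: "(\<lambda>x. \<integral>\<^sup>+ w. ?pos (x, w) \<partial>L) \<in> borel_measurable Mx"
      "(\<lambda>x. \<integral>\<^sup>+ w. ?neg (x, w) \<partial>L) \<in> borel_measurable Mx"
      by (rule measurable_section, measurable)+
    have "?g ?pos xu + ?g ?neg xu
      = (\<integral>\<^sup>+ y. pc xu y * (\<integral>\<^sup>+ w. ?pos (glue xu y, w) \<partial>L) + pc xu y * (\<integral>\<^sup>+ w. ?neg (glue xu y, w) \<partial>L) \<partial>Mv)"
      unfolding elim(2,3) by (rule nn_integral_add[symmetric]) measurable
    also have "\<dots> \<le> (\<integral>\<^sup>+ y. pc xu y * \<phi> (glue xu y) \<partial>Mv)"
    proof (rule nn_integral_mono_AE)
      show "AE y in Mv. pc xu y * (\<integral>\<^sup>+ w. ?pos (glue xu y, w) \<partial>L) + pc xu y * (\<integral>\<^sup>+ w. ?neg (glue xu y, w) \<partial>L)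
        \<le> pc xu y * \<phi> (glue xu y)"
        using elim(5) AE_space
      proof eventually_elim
        case (elim y)
        have x: "glue xu y \<in> space Mx"
          by (rule measurable_space[OF glue_section[OF xu] elim(2)])
        have [measurable]: "(\<lambda>w. f (glue xu y, w)) \<in> borel_measurable L"
          using measurable_compose[OF measurable_Pair1'[OF x] f] .
        have "(\<integral>\<^sup>+ w. ?pos (glue xu y, w) \<partial>L) + (\<integral>\<^sup>+ w. ?neg (glue xu y, w) \<partial>L)
          = (\<integral>\<^sup>+ w. ?pos (glue xu y, w) + ?neg (glue xu y, w) \<partial>L)"
          by (rule nn_integral_add[symmetric]) measurable
        also have "\<dots> = (\<integral>\<^sup>+ w. ennreal \<bar>f (glue xu y, w)\<bar> \<partial>L)"
          by (intro nn_integral_cong) (auto simp: abs_if ennreal_neg)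
        finally show ?case
          using elim(1) by (cases "pc xu y = 0") (auto simp: distrib_left[symmetric] intro: mult_left_mono)
      qed
    qed
    finally have "ennreal \<bar>m xu\<bar> \<le> \<mu> xu"
      using elim(1,4) by (auto intro: order_trans)
    then have "(ennreal \<bar>m xu\<bar>)\<^sup>2 \<le> (\<mu> xu)\<^sup>2" by (simp only: ennreal_power2_mono_iff)
    then show ?case by (simp add: ennreal_power)
  qed
qed

section \<open>The optimal conditional density\<close>

abbreviation "qopt \<equiv> opt_cond k u P f pu pc"

lemma opt_cond_is_cond_density: "is_cond_density k u qopt"
  unfolding is_cond_density_def
proof
  have "(\<lambda>z. if \<mu> (fst z) = 0 \<or> pu (fst z) = 0 then pc (fst z) (snd z)
      else pc (fst z) (snd z) * \<phi> (merge u v z) / \<mu> (fst z)) \<in> borel_measurable (Mu \<Otimes>\<^sub>M Mv)"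
    by measurable
  then show "(\<lambda>(xu, y). qopt xu y) \<in> borel_measurable (Mu \<Otimes>\<^sub>M Mv)"
    by (simp add: opt_cond_def case_prod_beta')
next
  have *: "AE xu in Mu. pu xu \<noteq> 0 \<longrightarrow> \<mu> xu = (\<integral>\<^sup>+ y. pc xu y * \<phi> (glue xu y) \<partial>Mv) \<and> \<mu> xu \<noteq> \<infinity>"
    using phi_mean_eq phi_mean_finite unfolding AE_Nu by eventually_elim simp
  show "AE xu in Mu. (\<integral>\<^sup>+ y. qopt xu y \<partial>Mv) = 1"
    using * cond_density_integral[OF pc] AE_space
  proof eventually_elim
    case (elim xu)
    note [measurable] = cond_density_section[OF pc elim(3)] glue_section[OF elim(3)]
    show ?case
    proof (cases "\<mu> xu = 0 \<or> pu xu = 0")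
      case False
      then have "(\<integral>\<^sup>+ y. qopt xu y \<partial>Mv) = (\<integral>\<^sup>+ y. pc xu y * \<phi> (glue xu y) \<partial>Mv) / \<mu> xu"
        unfolding opt_cond_def by (simp add: nn_integral_divide)
      also have "\<dots> = 1"
        using False elim(1) by (metis ennreal_divide_self infinity_ennreal_def less_top)
      finally show ?thesis .
    qed (simp add: opt_cond_def elim)
  qed
qed

lemma supp_a_opt_cond: "AE xu in Nu. supp_a_at k u P f pc qopt xu"
  using phi_mean_finite
proof eventually_elim
  case (elim xu)
  then show ?case
    unfolding supp_a_at_def opt_cond_def
    by (intro AE_I2) (auto simp: zero_less_iff_neq_zero ennreal_divide_eq_0_iff)
qed

text \<open>
  This is \<open>weighted_second_moment_eq\<close> on the fibre, unless \<open>E[\<phi> | xu] = 0\<close>: then \<open>pc \<phi>\<close> vanishes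
  almost everywhere on the fibre and both sides are \<open>0\<close>.
\<close>

lemma weighted_opt_cond: "AE xu in Nu. weighted_phi_sq_mean k u P f pc qopt xu = (\<mu> xu)\<^sup>2"
proof -
  have "AE xu in Nu. pu xu \<noteq> 0" by (simp add: AE_Nu)
  then show ?thesis
    using weighted_eq[OF opt_cond_is_cond_density] phi_mean_eq phi_mean_finite AE_Nu_if_Mu[OF pc_finite]
      AE_Nu_if_Mu[OF AE_space]
  proof eventually_elim
    case (elim xu)
    note [measurable] = cond_density_section[OF pc elim(6)] glue_section[OF elim(6)]
    show ?case
    proof (cases "\<mu> xu = 0")
      case True
      then have "AE y in Mv. pc xu y * \<phi> (glue xu y) = 0"
        using elim(3) by (simp add: nn_integral_0_iff_AE)
      then have "AE y in Mv. pc xu y * (pc xu y / qopt xu y * (\<phi> (glue xu y))\<^sup>2) = 0"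
        by eventually_elim auto
      then have "weighted_phi_sq_mean k u P f pc qopt xu = (\<integral>\<^sup>+ y. 0 \<partial>Mv)"
        unfolding elim(2) by (rule nn_integral_cong_AE)
      then show ?thesis using True by simp
    next
      case False
      then have "weighted_phi_sq_mean k u P f pc qopt xu
        = (\<integral>\<^sup>+ y. pc xu y * (pc xu y / (pc xu y * \<phi> (glue xu y) / \<mu> xu) * (\<phi> (glue xu y))\<^sup>2) \<partial>Mv)"
        using elim(1) unfolding elim(2) by (simp add: opt_cond_def)
      also have "\<dots> = (\<mu> xu)\<^sup>2"
        by (rule weighted_second_moment_eq) (use elim False in auto)
      finally show ?thesis .
    qed
  qed
qed

section \<open>The optimal marginal density\<close>

definition rootS :: "((nat \<Rightarrow> real) \<Rightarrow> (nat \<Rightarrow> real) \<Rightarrow> ennreal) \<Rightarrow> (nat \<Rightarrow> real) \<Rightarrow> ennreal" where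
  "rootS qc xu = ennsqrt (e2ennreal (S_fun k u P f pc qc xu))"

lemma measurable_S [measurable]: "(\<lambda>xu. S_fun k u P f pc qc xu) \<in> borel_measurable Mu"
  unfolding S_fun_eq by measurable

lemma measurable_rootS [measurable]: "rootS qc \<in> borel_measurable Mu"
  unfolding rootS_def[abs_def] by measurable

lemma sigma2_opt_eq:
  assumes [measurable]: "qu \<in> borel_measurable Mu"
  shows "sigma2_opt k u P f pu pc qu qc
    = enn2ereal (\<integral>\<^sup>+ xu. pu xu * (pu xu / qu xu * (rootS qc xu)\<^sup>2) \<partial>Mu) - ereal ((eta u P f)\<^sup>2)"
  unfolding sigma2_opt_def rootS_def ennsqrt_power2
  by (subst nn_integral_P_u[symmetric]) simp_all

lemma sqrt_S_mean_eq: "sqrt_S_mean k u P f pc qc = (\<integral>\<^sup>+ xu. pu xu * rootS qc xu \<partial>Mu)"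
  unfolding sqrt_S_mean_def rootS_def by (rule nn_integral_P_u) measurable

lemma rootS_eq_0: "m xu = 0 \<Longrightarrow> rootS qc xu = 0"
  by (simp add: rootS_def S_fun_eq zero_ennreal_def[symmetric])

lemma pu_finite: "AE xu in Mu. pu xu \<noteq> \<infinity>"
  using integral_pu by (intro nn_integral_PInf_AE) auto

text \<open>
  The basic inequality on the space of \<open>xu\<close>. Its support hypothesis follows from condition (b), because
  \<open>S\<close> vanishes together with \<open>m\<close>.
\<close>

lemma sigma2_opt_ge:
  assumes "is_density u qu" "supp_b u P f pu qu"
  shows "enn2ereal ((sqrt_S_mean k u P f pc qc)\<^sup>2) - ereal ((eta u P f)\<^sup>2) \<le> sigma2_opt k u P f pu pc qu qc"
proof -
  have [measurable]: "qu \<in> borel_measurable Mu" and 1: "(\<integral>\<^sup>+ x. qu x \<partial>Mu) = 1"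
    using assms(1) by (simp_all add: is_density_def)
  have "AE xu in Mu. pu xu * rootS qc xu > 0 \<longrightarrow> qu xu > 0"
    using assms(2) unfolding supp_b_def
    by eventually_elim (auto simp: zero_less_iff_neq_zero dest: rootS_eq_0)
  then show ?thesis
    unfolding sigma2_opt_eq[OF \<open>qu \<in> _\<close>] sqrt_S_mean_eq
    by (intro ereal_minus_mono order_refl weighted_second_moment_ge[THEN less_eq_ennreal.rep_eq[THEN iffD1]] 1) simp_all
qed

text \<open>
  \<open>S \<ge> m\<^sup>4\<close>, because \<open>m\<^sup>2 \<le> E[\<phi> | xu]\<^sup>2 \<le> V\<close>, where \<open>V\<close> is the weighted second moment.
  Hence \<open>E[sqrt S] \<ge> \<eta>\<close>, and the optimal marginal is positive wherever condition (b) asks for it.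
\<close>

lemma rootS_ge:
  assumes qc: "is_cond_density k u qc" and a: "AE xu in Nu. supp_a_at k u P f pc qc xu"
  shows "AE xu in Nu. ennreal ((m xu)\<^sup>2) \<le> rootS qc xu"
  using m_le_phi_mean weighted_ge[OF qc] a
  by eventually_elim (auto simp: rootS_def S_fun_eq intro!: ennsqrt_S_of_ge)

lemma sqrt_S_mean_nonzero:
  assumes qc: "is_cond_density k u qc" and a: "AE xu in Nu. supp_a_at k u P f pc qc xu"
    and eta: "eta u P f > 0"
  shows "sqrt_S_mean k u P f pc qc \<noteq> 0"
proof
  assume 0: "sqrt_S_mean k u P f pc qc = 0"
  have "(\<integral>\<^sup>+ \<omega>. ennreal ((m (X_part u \<omega>))\<^sup>2) \<partial>P) = (\<integral>\<^sup>+ xu. pu xu * ennreal ((m xu)\<^sup>2) \<partial>Mu)"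
    by (rule nn_integral_P_u) measurable
  also have "\<dots> \<le> (\<integral>\<^sup>+ xu. pu xu * rootS qc xu \<partial>Mu)"
    by (rule nn_integral_pu_mono[OF rootS_ge[OF qc a]])
  finally have "(\<integral>\<^sup>+ \<omega>. ennreal ((m (X_part u \<omega>))\<^sup>2) \<partial>P) = 0"
    using 0 by (simp add: sqrt_S_mean_eq)
  then have "eta u P f = 0"
    unfolding eta_def by (subst integral_eq_nn_integral) simp_all
  with eta show False by simp
qed

lemma
  assumes qc: "is_cond_density k u qc" and a: "AE xu in Nu. supp_a_at k u P f pc qc xu"
    and eta: "eta u P f > 0" and fin: "sqrt_S_mean k u P f pc qc < \<infinity>"
  shows opt_marginal_density: "is_density u (opt_marginal k u P f pu pc qc)"
    and opt_marginal_supp_b: "supp_b u P f pu (opt_marginal k u P f pu pc qc)"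
    and sigma2_opt_opt_marginal: "sigma2_opt k u P f pu pc (opt_marginal k u P f pu pc qc) qc
      = enn2ereal ((sqrt_S_mean k u P f pc qc)\<^sup>2) - ereal ((eta u P f)\<^sup>2)"
proof -
  let ?q = "opt_marginal k u P f pu pc qc" and ?c = "sqrt_S_mean k u P f pc qc"
  have c: "?c \<noteq> 0" by (rule sqrt_S_mean_nonzero[OF qc a eta])
  have q: "?q = (\<lambda>xu. pu xu * rootS qc xu / ?c)"
    by (simp add: opt_marginal_def[abs_def] rootS_def)
  have [measurable]: "?q \<in> borel_measurable Mu" unfolding q by measurable
  have "(\<integral>\<^sup>+ xu. ?q xu \<partial>Mu) = ?c / ?c"
    unfolding q sqrt_S_mean_eq by (rule nn_integral_divide) measurable
  then show "is_density u ?q"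
    using c fin by (simp add: is_density_def ennreal_divide_self)
  show "supp_b u P f pu ?q"
    using rootS_ge[OF qc a] unfolding AE_Nu supp_b_def
  proof eventually_elim
    case (elim xu)
    then show ?case using fin
      by (auto simp: q zero_less_iff_neq_zero ennreal_divide_eq_0_iff)
  qed
  show "sigma2_opt k u P f pu pc ?q qc = enn2ereal (?c\<^sup>2) - ereal ((eta u P f)\<^sup>2)"
    unfolding sigma2_opt_eq[OF \<open>?q \<in> _\<close>] unfolding q
    using c fin by (subst weighted_second_moment_eq) (auto simp: sqrt_S_mean_eq intro: pu_finite[simplified])
qed

section \<open>Comparing sampling densities\<close>

lemma S_opt_cond_le:
  assumes qc: "is_cond_density k u qc"
  shows "AE xu in Nu. supp_a_at k u P f pc qc xu \<longrightarrow> S_fun k u P f pc qopt xu \<le> S_fun k u P f pc qc xu"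
  using weighted_ge[OF qc] weighted_opt_cond
  by eventually_elim (auto simp: S_fun_eq intro!: S_of_mono)

text \<open>
  The integrands are compared pointwise. Where \<open>qu > 0\<close>, condition (a) holds and \<open>opt_cond\<close> has the
  smaller \<open>S\<close>. Where \<open>qu = 0 < pu\<close> the weight is infinite, but condition (b) gives \<open>m = 0\<close> there, so
  that both integrands are \<open>0\<close>.
\<close>

lemma sigma2_opt_opt_cond_le:
  assumes qu: "is_density u qu" and qc: "is_cond_density k u qc" and ad: "admissible k u P f pu pc qu qc"
  shows "sigma2_opt k u P f pu pc qu qopt \<le> sigma2_opt k u P f pu pc qu qc"
proof -
  have [measurable]: "qu \<in> borel_measurable Mu"
    using qu by (simp add: is_density_def)
  have "AE xu in Mu. pu xu \<noteq> 0 \<and> qu xu \<noteq> 0 \<longrightarrow> supp_a_at k u P f pc qc xu"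
    using ad by (auto simp: admissible_def zero_less_iff_neq_zero)
  moreover have "AE xu in Mu. pu xu \<noteq> 0 \<and> m xu \<noteq> 0 \<longrightarrow> qu xu \<noteq> 0"
    using ad by (auto simp: admissible_def supp_b_def zero_less_iff_neq_zero)
  ultimately have "AE xu in Mu. pu xu * (pu xu / qu xu * (rootS qopt xu)\<^sup>2) \<le> pu xu * (pu xu / qu xu * (rootS qc xu)\<^sup>2)"
    using S_opt_cond_le[OF qc] unfolding AE_Nu
  proof eventually_elim
    case (elim xu)
    show ?case
    proof (cases "pu xu = 0 \<or> m xu = 0")
      case False
      with elim have "rootS qopt xu \<le> rootS qc xu"
        by (auto simp: rootS_def intro!: ennsqrt_mono e2ennreal_mono)
      then show ?thesis by (intro mult_left_mono power_mono) auto
    qed (auto simp: rootS_eq_0)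
  qed
  then show ?thesis
    unfolding sigma2_opt_eq[OF \<open>qu \<in> _\<close>]
    by (intro ereal_minus_mono order_refl nn_integral_mono_AE[THEN less_eq_ennreal.rep_eq[THEN iffD1]])
qed

lemma admissible_opt_cond:
  "supp_b u P f pu qu \<Longrightarrow> admissible k u P f pu pc qu qopt"
  using supp_a_opt_cond unfolding admissible_def AE_Nu
  by (auto elim!: eventually_mono)

lemma sqrt_S_mean_pc_finite: "sqrt_S_mean k u P f pc pc < \<infinity>"
proof -
  have "AE xu in Nu. rootS pc xu \<le> 2 * phi_sq_mean k u P f xu"
    using m_le_phi_mean phi_mean_power2_le weighted_pc
  proof eventually_elim
    case (elim xu)
    from elim(1,2) have "ennreal ((m xu)\<^sup>2) \<le> phi_sq_mean k u P f xu" by (rule order_trans)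
    then show ?case unfolding rootS_def S_fun_eq elim(3) by (rule ennsqrt_S_of_le)
  qed
  then have "sqrt_S_mean k u P f pc pc \<le> (\<integral>\<^sup>+ xu. pu xu * (2 * phi_sq_mean k u P f xu) \<partial>Mu)"
    unfolding sqrt_S_mean_eq by (rule nn_integral_pu_mono)
  also have "\<dots> = (\<integral>\<^sup>+ xu. 2 * (pu xu * phi_sq_mean k u P f xu) \<partial>Mu)"
    by (simp only: mult.left_commute)
  also have "\<dots> = 2 * (\<integral>\<^sup>+ xu. pu xu * phi_sq_mean k u P f xu \<partial>Mu)"
    by (rule nn_integral_cmult) measurable
  also have "\<dots> < \<infinity>"
    using nn_integral_phi_sq_mean by (simp add: ennreal_mult_less_top)
  finally show ?thesis .
qed

lemma sqrt_S_mean_opt_cond_le: "sqrt_S_mean k u P f pc qopt \<le> sqrt_S_mean k u P f pc pc"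
proof -
  have "AE xu in Nu. rootS qopt xu \<le> rootS pc xu"
    using S_opt_cond_le[OF pc]
    by eventually_elim (simp add: supp_a_pc rootS_def ennsqrt_mono e2ennreal_mono)
  then show ?thesis unfolding sqrt_S_mean_eq by (rule nn_integral_pu_mono)
qed

lemma S_pc_eq: "AE xu in Nu. S_fun k u P f pc pc xu = S_of (m xu) (phi_sq_mean k u P f xu)"
  using weighted_pc by eventually_elim (simp add: S_fun_eq)

lemma S_opt_cond_eq: "AE xu in Nu. S_fun k u P f pc qopt xu
  = ereal (4 * (m xu)\<^sup>2) * enn2ereal ((\<mu> xu)\<^sup>2) - ereal (3 * (m xu) ^ 4)"
  using weighted_opt_cond phi_mean_finite
proof eventually_elim
  case (elim xu)
  obtain r where r: "\<mu> xu = ennreal r" "r \<ge> 0" using elim(2) by (cases "\<mu> xu") auto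
  have "(\<mu> xu)\<^sup>2 = ennreal (r\<^sup>2)" using r by (simp add: ennreal_power)
  then show ?case
    by (simp add: S_fun_eq elim(1) S_of_ennreal) (simp add: algebra_simps power4_eq_xxxx power2_eq_square)
qed

lemma supp_b_pu: "supp_b u P f pu pu"
  by (auto simp: supp_b_def zero_less_iff_neq_zero)

end

section \<open>The optimal sampling density\<close>

theorem mainTheorem3:
  fixes k d :: nat
    and u :: "nat set"
    and L :: "(nat \<Rightarrow> real) measure"
    and P :: "((nat \<Rightarrow> real) \<times> (nat \<Rightarrow> real)) measure"
    and f :: "(nat \<Rightarrow> real) \<times> (nat \<Rightarrow> real) \<Rightarrow> real"
    and pu :: "(nat \<Rightarrow> real) \<Rightarrow> ennreal"
    and pc :: "(nat \<Rightarrow> real) \<Rightarrow> (nat \<Rightarrow> real) \<Rightarrow> ennreal"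
  assumes u: "u \<noteq> {}" "u \<subseteq> {1..k}"
    and W: "prob_space L" "sets L = sets (\<Pi>\<^sub>M j\<in>{1..d}. (borel :: real measure))"
    and f: "f \<in> borel_measurable (lborel_on {1..k} \<Otimes>\<^sub>M L)"
    and p: "is_density u pu" "is_cond_density k u pc"
    and P: "P = law k (joint_density k u pu pc) L"
    and Y2: "integrable P (\<lambda>\<omega>. (f \<omega>)\<^sup>2)"
    and eta: "eta u P f > 0"
  shows
    "(\<forall>qu. is_density u qu \<and> supp_b u P f pu qu \<longrightarrow>
        is_cond_density k u (opt_cond k u P f pu pc) \<and>
        admissible k u P f pu pc qu (opt_cond k u P f pu pc) \<and>
        (\<forall>qc. is_cond_density k u qc \<and> admissible k u P f pu pc qu qc \<longrightarrow>
           sigma2_opt k u P f pu pc qu (opt_cond k u P f pu pc)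
             \<le> sigma2_opt k u P f pu pc qu qc)) \<and>
     (AE xu in density (lborel_on u) pu.
        weighted_phi_sq_mean k u P f pc (opt_cond k u P f pu pc) xu = (phi_mean k u P f xu)\<^sup>2) \<and>
     (\<forall>qc. is_cond_density k u qc \<and>
        (AE xu in density (lborel_on u) pu. supp_a_at k u P f pc qc xu) \<and>
        sqrt_S_mean k u P f pc qc < \<infinity> \<longrightarrow>
        is_density u (opt_marginal k u P f pu pc qc) \<and>
        supp_b u P f pu (opt_marginal k u P f pu pc qc) \<and>
        (\<forall>qu. is_density u qu \<and> supp_b u P f pu qu \<longrightarrow>
           sigma2_opt k u P f pu pc (opt_marginal k u P f pu pc qc) qc
             \<le> sigma2_opt k u P f pu pc qu qc) \<and>
        sigma2_opt k u P f pu pc (opt_marginal k u P f pu pc qc) qc =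
          enn2ereal ((sqrt_S_mean k u P f pc qc)\<^sup>2) - ereal ((eta u P f)\<^sup>2)) \<and>
     (let qs = opt_cond k u P f pu pc;
         SA = S_fun k u P f pc pc;
         SB = S_fun k u P f pc qs;
         qA = opt_marginal k u P f pu pc pc;
         qB = opt_marginal k u P f pu pc qs
     in (AE xu in density (lborel_on u) pu.
           SA xu = ereal (4 * (m_fun u P f xu)\<^sup>2)
                     * (enn2ereal (phi_sq_mean k u P f xu) - ereal ((m_fun u P f xu)\<^sup>2))
                   + ereal ((m_fun u P f xu) ^ 4)) \<and>
        (AE xu in density (lborel_on u) pu.
           SB xu = ereal (4 * (m_fun u P f xu)\<^sup>2) * enn2ereal ((phi_mean k u P f xu)\<^sup>2)
                   - ereal (3 * (m_fun u P f xu) ^ 4)) \<and>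
        (AE xu in density (lborel_on u) pu. SB xu \<le> SA xu) \<and>
        is_density u qA \<and> is_density u qB \<and> is_cond_density k u qs \<and>
        admissible k u P f pu pc qB qs \<and>
        (\<forall>qu qc. is_density u qu \<and> is_cond_density k u qc \<and> admissible k u P f pu pc qu qc \<longrightarrow>
           sigma2_opt k u P f pu pc qB qs \<le> sigma2_opt k u P f pu pc qu qc) \<and>
        sigma2_opt k u P f pu pc qB qs \<le> sigma2_opt k u P f pu pc qA pc \<and>
        sigma2_opt k u P f pu pc qA pc \<le> sigma2_opt k u P f pu pc pu pc)"
proof -
  interpret reference_model k u L P f pu pc
    by (intro reference_model.intro u(2) W(1) f p P Y2)
  note pc_a = AE_I2[of Nu, OF supp_a_pc]
  note opt = opt_cond_is_cond_density supp_a_opt_cond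
  have fin_B: "sqrt_S_mean k u P f pc qopt < \<infinity>"
    using sqrt_S_mean_opt_cond_le sqrt_S_mean_pc_finite by (rule le_less_trans)
  note A = opt_marginal_density[OF p(2) pc_a eta sqrt_S_mean_pc_finite]
    sigma2_opt_opt_marginal[OF p(2) pc_a eta sqrt_S_mean_pc_finite]
  note B = opt_marginal_density[OF opt eta fin_B] opt_marginal_supp_b[OF opt eta fin_B]
    sigma2_opt_opt_marginal[OF opt eta fin_B]
  let ?qA = "opt_marginal k u P f pu pc pc" and ?qB = "opt_marginal k u P f pu pc qopt"
  have opt_cond_best: "is_cond_density k u qopt \<and> admissible k u P f pu pc qu qopt \<and>
      (\<forall>qc. is_cond_density k u qc \<and> admissible k u P f pu pc qu qc \<longrightarrow>
         sigma2_opt k u P f pu pc qu qopt \<le> sigma2_opt k u P f pu pc qu qc)"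
    if "is_density u qu" "supp_b u P f pu qu" for qu
    using that opt(1) admissible_opt_cond sigma2_opt_opt_cond_le by blast
  have opt_marginal_best: "is_density u (opt_marginal k u P f pu pc qc) \<and>
      supp_b u P f pu (opt_marginal k u P f pu pc qc) \<and>
      (\<forall>qu. is_density u qu \<and> supp_b u P f pu qu \<longrightarrow>
         sigma2_opt k u P f pu pc (opt_marginal k u P f pu pc qc) qc
           \<le> sigma2_opt k u P f pu pc qu qc) \<and>
      sigma2_opt k u P f pu pc (opt_marginal k u P f pu pc qc) qc =
        enn2ereal ((sqrt_S_mean k u P f pc qc)\<^sup>2) - ereal ((eta u P f)\<^sup>2)"
    if qc: "is_cond_density k u qc" "AE xu in Nu. supp_a_at k u P f pc qc xu"
      and fin: "sqrt_S_mean k u P f pc qc < \<infinity>" for qc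
    using opt_marginal_density[OF qc eta fin] opt_marginal_supp_b[OF qc eta fin]
      sigma2_opt_opt_marginal[OF qc eta fin] sigma2_opt_ge by simp
  have joint_opt: "sigma2_opt k u P f pu pc ?qB qopt \<le> sigma2_opt k u P f pu pc qu qc"
    if "is_density u qu" "is_cond_density k u qc" "admissible k u P f pu pc qu qc" for qu qc
  proof -
    have "sigma2_opt k u P f pu pc ?qB qopt \<le> sigma2_opt k u P f pu pc qu qopt"
      unfolding B(3) using that by (intro sigma2_opt_ge) (auto simp: admissible_def)
    also have "\<dots> \<le> sigma2_opt k u P f pu pc qu qc"
      by (rule sigma2_opt_opt_cond_le[OF that])
    finally show ?thesis .
  qed
  have B_le_A: "sigma2_opt k u P f pu pc ?qB qopt \<le> sigma2_opt k u P f pu pc ?qA pc"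
    unfolding A B
    by (intro ereal_minus_mono order_refl power_mono[THEN less_eq_ennreal.rep_eq[THEN iffD1]]
      sqrt_S_mean_opt_cond_le) simp
  have A_le_p: "sigma2_opt k u P f pu pc ?qA pc \<le> sigma2_opt k u P f pu pc pu pc"
    unfolding A by (rule sigma2_opt_ge[OF p(1) supp_b_pu])
  have S_le: "AE xu in Nu. S_fun k u P f pc qopt xu \<le> S_fun k u P f pc pc xu"
    using S_opt_cond_le[OF p(2)] by (simp add: supp_a_pc)
  show ?thesis
    unfolding Let_def
    by (intro conjI allI impI; (elim conjE)?)
      (use opt_cond_best opt_marginal_best weighted_opt_cond S_pc_eq[unfolded S_of_def] S_opt_cond_eq S_le
        A(1) B(1) opt(1) admissible_opt_cond[OF B(2)] joint_opt B_le_A A_le_p in blast)+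
qed

end
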